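(* Fix an index $i$ and scalars $\mu_i$, $\lambda$ and $\rho_i>0$. Let $A_i,B_i,C_i,D_i,L_i,T_i$ be given real matrices with $A_i$ stable, as in the context. Suppose there exist real matrices $W_i,Y_i,Z_i,\hat F_i,\hat G_i,\hat H_i,\hat K_i$, with $W_i,Y_i,Z_i$ symmetric, such that $\mathrm{Tr}(W_i)<\mu_i$ and the following linear matrix inequalities hold ($*$ denotes blocks determined by symmetry): $$\begin{bmatrix} W_i & L_i-\hat K_iC_i-\hat H_i & L_i-\hat K_iC_i & -\hat K_iD_i \\ * & Z_i & Z_i & 0 \\ * & * & Y_i & 0 \\ * & * & * & I \end{bmatrix}\succ0,$$ $$\begin{bmatrix} Z_i & Z_i & 0 & 0 & 0 & 0 \\ * & Y_i & 0 & \hat F_i & 0 & \hat G_iC_iT_i \\ * & * & \frac{\lambda}{\rho_i^2}I & \hat H_i & 0 & \hat K_iC_iT_i \\ * & * & * & Z_i & Z_i & 0 \\ * & * & * & * & Y_i & 0 \\ * & * & * & * & * & I \end{bmatrix}\succ0,$$ $$\begin{bmatrix} Z_i & Z_i & Z_iA_i & Z_iA_i & Z_iB_i \\ * & Y_i & Y_iA_i+\hat G_iC_i+\hat F_i & Y_iA_i+\hat G_iC_i & Y_iB_i+\hat G_iD_i \\ * & * & Z_i & Z_i & 0 \\ * & * & * & Y_i & 0 \\ * & * & * & * & I \end{bmatrix}\succ0.$$ Then there exist admissible filter matrices $F_i,G_i,H_i,K_i$, i.e. with $F_i$ stable and satisfying $$\|\tilde C_i(zI-\tilde A_i)^{-1}\tilde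 B_i+\tilde D_i\|_2^2\le\mu_i,\qquad \rho_i^2\,\|H_i(zI-F_i)^{-1}G_iC_iT_i+K_iC_iT_i\|_\infty^2\le\lambda .$$ Moreover, such matrices are recovered by setting $$F_i=V_i^{-1}\hat F_iZ_i^{-1}U_i^{-T},\quad G_i=V_i^{-1}\hat G_i,\quad H_i=\hat H_iZ_i^{-1}U_i^{-T},\quad K_i=\hat K_i,$$ where $U_i,V_i$ are any two nonsingular matrices such that $V_iU_i^T=I-Y_iZ_i^{-1}$.
   Context: **System.** $x_{i,t+1}=A_ix_{i,t}+B_iw_{i,t}$, $y_{i,t}=C_ix_{i,t}+D_iw_{i,t}$, with $w_i$ standard white Gaussian noise and quantity of interest $z_i=L_ix_i$. $A_i$ is a square matrix that is stable (all eigenvalues in the open unit disk), $D_i$ has full row rank, $(A_i,C_i)$ is detectable and $(A_i,B_i)$ is stabilizable. $T_i$ is a diagonal matrix with entries in $\{0,1\}$, of the same size as $A_i$. **Filter.** $\hat x_{i,t+1}=F_i\hat x_{i,t}+G_iy_{i,t}$, $\hat z_{i,t}=H_i\hat x_{i,t}+K_iy_{i,t}$, where $F_i$ is required to be stable. In the recovery formula $F_i$ has the same size as $A_i$. The matrices $Y_i,Z_i,\hat F_i,U_i,V_i$ are square of the size of $A_i$; $\hat G_i,\hat H_i,\hat K_i$ have the sizes of $G_i,H_i,K_i$; $W_i$ is square with as many rows as $L_i$. **Combined dynamics** from $w_i$ to the error $z_i-\hat z_i$: $$\tilde A_i=\begin{bmatrix} A_i & 0 \\ G_iC_i & F_i \end{bmatrix},\quad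 \tilde B_i=\begin{bmatrix} B_i \\ G_iD_i \end{bmatrix},\quad \tilde C_i=\begin{bmatrix} L_i-K_iC_i & -H_i \end{bmatrix},\quad \tilde D_i=-K_iD_i.$$ **Norms.** For a stable discrete-time transfer function $\mathcal G(z)$, $$\|\mathcal G\|_2=\Big(\tfrac1{2\pi}\int_{-\pi}^{\pi}\mathrm{Tr}\big(\mathcal G^*(e^{i\omega})\mathcal G(e^{i\omega})\big)d\omega\Big)^{1/2},\qquad \|\mathcal G\|_\infty=\operatorname{ess\,sup}_{\omega\in[-\pi,\pi)}\sigma_{\max}(\mathcal G(e^{i\omega})),$$ where $\sigma_{\max}$ is the largest singular value. The notation $\succ0$ means symmetric positive definite, and $U^{-T}=(U^{-1})^T$. *)

theory Defs
  imports "HOL-Analysis.Analysis" "HOL-Probability.Essential_Supremum"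
begin

definition cmat :: "real^'n^'m \<Rightarrow> complex^'n^'m" where
  "cmat M = map_matrix complex_of_real M"

definition ctranspose :: "complex^'n^'m \<Rightarrow> complex^'m^'n" where
  "ctranspose M = transpose (map_matrix cnj M)"

definition is_eigenvalue :: "complex^'n^'n \<Rightarrow> complex \<Rightarrow> bool" where
  "is_eigenvalue M c \<longleftrightarrow> (\<exists>v. v \<noteq> 0 \<and> M *v v = c *s v)"

definition schur_stable :: "real^'n^'n \<Rightarrow> bool" where
  "schur_stable A \<longleftrightarrow> (\<forall>c. is_eigenvalue (cmat A) c \<longrightarrow> cmod c < 1)"

definition stabilizable :: "real^'n^'n \<Rightarrow> real^'w^'n \<Rightarrow> bool" where
  "stabilizable A B \<longleftrightarrow> (\<exists>K :: real^'n^'w. schur_stable (A + B ** K))"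

definition detectable :: "real^'n^'n \<Rightarrow> real^'n^'y \<Rightarrow> bool" where
  "detectable A C \<longleftrightarrow> (\<exists>K :: real^'y^'n. schur_stable (A + K ** C))"

definition full_row_rank :: "real^'n^'m \<Rightarrow> bool" where
  "full_row_rank D \<longleftrightarrow> rank D = CARD('m)"

definition zero_one_diagonal :: "real^'n^'n \<Rightarrow> bool" where
  "zero_one_diagonal T \<longleftrightarrow> (\<forall>i j. i \<noteq> j \<longrightarrow> T $ i $ j = 0) \<and> (\<forall>i. T $ i $ i \<in> {0, 1})"

definition symmetric :: "real^'n^'n \<Rightarrow> bool" where
  "symmetric M \<longleftrightarrow> transpose M = M"

definition positive_definite :: "real^'n^'n \<Rightarrow> bool" where
  "positive_definite M \<longleftrightarrow> symmetric M \<and> (\<forall>x. x \<noteq> 0 \<longrightarrow> 0 < x \<bullet> (M *v x))"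

text \<open>Block matrices are indexed by sum types, rows being the outer index of a matrix.\<close>

definition hcat :: "real^'n^'m \<Rightarrow> real^'k^'m \<Rightarrow> real^('n + 'k)^'m"  (infixr "|||" 60) where
  "P ||| Q = (\<chi> i j. case j of Inl a \<Rightarrow> P $ i $ a | Inr b \<Rightarrow> Q $ i $ b)"

definition vcat :: "real^'n^'m \<Rightarrow> real^'n^'k \<Rightarrow> real^'n^('m + 'k)" where
  "vcat P Q = (\<chi> i. case i of Inl a \<Rightarrow> P $ a | Inr b \<Rightarrow> Q $ b)"

text \<open>
  The symmetric block matrix with first block row [P, Q] and lower right block R, the lower
  left block being the transpose of Q. Nesting it in R gives a matrix by its upper triangle of blocks.
\<close>

definition sym_block :: "real^'m^'m \<Rightarrow> real^'n^'m \<Rightarrow> real^'n^'n \<Rightarrow> real^('m + 'n)^('m + 'n)" where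
  "sym_block P Q R = vcat (P ||| Q) (transpose Q ||| R)"

text \<open>The transfer function C (z I - A)^(-1) B + D; it is meaningful where z is no eigenvalue
  of A, which for Schur stable A includes the whole unit circle.\<close>

definition transfer ::
  "real^'n^'n \<Rightarrow> real^'u^'n \<Rightarrow> real^'n^'p \<Rightarrow> real^'u^'p \<Rightarrow> complex \<Rightarrow> complex^'u^'p" where
  "transfer A B C D z = cmat C ** matrix_inv (mat z - cmat A) ** cmat B + cmat D"

definition singular_values :: "complex^'n^'m \<Rightarrow> real set" where
  "singular_values M = {s. 0 \<le> s \<and> is_eigenvalue (ctranspose M ** M) (complex_of_real (s\<^sup>2))}"

definition sigma_max :: "complex^'n^'m \<Rightarrow> real" where
  "sigma_max M = Max (singular_values M)"

text \<open>The trace in the integrand is a nonnegative real. For stable transfer functions the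
  integrand is continuous in \<open>\<omega>\<close>, so the integral exists.\<close>

definition h2_norm :: "(complex \<Rightarrow> complex^'u^'p) \<Rightarrow> real" where
  "h2_norm g = sqrt (1 / (2 * pi) *
     (LBINT \<omega>:{-pi..pi}. Re (trace (ctranspose (g (cis \<omega>)) ** g (cis \<omega>)))))"

definition hinf_norm :: "(complex \<Rightarrow> complex^'u^'p) \<Rightarrow> ereal" where
  "hinf_norm g =
     esssup (restrict_space lborel {-pi..<pi}) (\<lambda>\<omega>. ereal (sigma_max (g (cis \<omega>))))"

text \<open>Realization of the dynamics from the noise to the estimation error, with stacked state (plant, filter).\<close>

definition err_A :: "real^'n^'n \<Rightarrow> real^'n^'y \<Rightarrow> real^'n^'n \<Rightarrow> real^'y^'n \<Rightarrow> real^('n + 'n)^('n + 'n)" where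
  "err_A A C F G = vcat (A ||| 0) (G ** C ||| F)"

definition err_B :: "real^'w^'n \<Rightarrow> real^'w^'y \<Rightarrow> real^'y^'n \<Rightarrow> real^'w^('n + 'n)" where
  "err_B B D G = vcat B (G ** D)"

definition err_C :: "real^'n^'y \<Rightarrow> real^'n^'z \<Rightarrow> real^'n^'z \<Rightarrow> real^'y^'z \<Rightarrow> real^('n + 'n)^'z" where
  "err_C C L H K = (L - K ** C ||| - H)"

definition err_D :: "real^'w^'y \<Rightarrow> real^'y^'z \<Rightarrow> real^'w^'z" where
  "err_D D K = - (K ** D)"

definition err_transfer ::
  "real^'n^'n \<Rightarrow> real^'w^'n \<Rightarrow> real^'n^'y \<Rightarrow> real^'w^'y \<Rightarrow> real^'n^'z \<Rightarrow>
   real^'n^'n \<Rightarrow> real^'y^'n \<Rightarrow> real^'n^'z \<Rightarrow> real^'y^'z \<Rightarrow> complex \<Rightarrow> complex^'w^'z" where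
  "err_transfer A B C D L F G H K =
     transfer (err_A A C F G) (err_B B D G) (err_C C L H K) (err_D D K)"

definition admissible_filter ::
  "real^'n^'n \<Rightarrow> real^'w^'n \<Rightarrow> real^'n^'y \<Rightarrow> real^'w^'y \<Rightarrow> real^'n^'z \<Rightarrow> real^'n^'n \<Rightarrow>
   real \<Rightarrow> real \<Rightarrow> real \<Rightarrow>
   real^'n^'n \<Rightarrow> real^'y^'n \<Rightarrow> real^'n^'z \<Rightarrow> real^'y^'z \<Rightarrow> bool" where
  "admissible_filter A B C D L T \<mu> lam \<rho> F G H K \<longleftrightarrow>
     schur_stable F \<and>
     (h2_norm (err_transfer A B C D L F G H K))\<^sup>2 \<le> \<mu> \<and>
     ereal (\<rho>\<^sup>2) * (hinf_norm (transfer F (G ** C ** T) H (K ** C ** T)))\<^sup>2 \<le> ereal lam"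

end

theory Submission
  imports Defs
begin

text \<open>
  Put \<open>X = Y - Z\<close> and describe the filter state by \<open>\<xi> = Z\<^sup>-\<^sup>1 U\<^sup>-\<^sup>T h\<close>, where \<open>h\<close> is the original one. As
  \<open>V U\<^sup>T Z = - X\<close>, the filter dynamics become \<open>X \<xi>' = - (Fh \<xi> + Gh y)\<close>, without \<open>U\<close> and \<open>V\<close>.
  Evaluated at suitable block vectors, the three matrix inequalities are dissipation inequalities:
  the third one for plant and filter together (\<open>x\<close> being the plant state), with storage function \<open>x\<^sup>T Z x + (x - \<xi>)\<^sup>T X (x - \<xi>)\<close> and supply \<open>|w|\<^sup>2\<close>;
  the first one bounds the output of that system by its storage function, and the second one is a
  bounded real inequality for the filter with storage function \<open>\<xi>\<^sup>T X \<xi>\<close>.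

  At a frequency \<open>|z| = 1\<close> storage functions are invariant under multiplication of the state by \<open>z\<close>, so
  the second inequality bounds the transfer function pointwise. For the \<open>H\<^sub>2\<close> norm the inequalities are
  dualised: with \<open>\<eta>\<close> the state of the adjoint system, \<open>|g(z)\<^sup>* a|\<^sup>2\<close> is at most \<open>a\<^sup>T W a\<close> plus a term
  linear in \<open>\<eta>\<close>, and \<open>\<eta>\<close> has mean zero over the unit circle.
\<close>

subsection \<open>Block vectors, complexification and quadratic forms\<close>

definition vjoin :: "real^'m \<Rightarrow> real^'n \<Rightarrow> real^('m + 'n)" where
  "vjoin x y = (\<chi> i. case i of Inl a \<Rightarrow> x $ a | Inr b \<Rightarrow> y $ b)"

lemma sum_sum_type:
  fixes f :: "'m::finite + 'n::finite \<Rightarrow> 'a::comm_monoid_add"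
  shows "sum f UNIV = (\<Sum>a\<in>UNIV. f (Inl a)) + (\<Sum>b\<in>UNIV. f (Inr b))"
  by (simp add: sum.Plus flip: UNIV_Plus_UNIV)

lemma vjoin_eq_0_iff [simp]: "vjoin x y = 0 \<longleftrightarrow> x = 0 \<and> y = 0"
  by (auto simp: vjoin_def vec_eq_iff split: sum.splits)

lemma vjoin_surj: "\<exists>x y. v = vjoin x y"
proof (intro exI)
  show "v = vjoin (\<chi> i. v $ Inl i) (\<chi> i. v $ Inr i)"
    by (auto simp: vjoin_def vec_eq_iff split: sum.splits)
qed

lemma vjoin_add: "vjoin a b + vjoin c d = vjoin (a + c) (b + d)"
  by (auto simp: vjoin_def vec_eq_iff split: sum.splits)

lemma inner_vjoin [simp]: "vjoin a b \<bullet> vjoin c d = a \<bullet> c + b \<bullet> d"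
  by (simp add: inner_vec_def vjoin_def sum_sum_type)

lemma hcat_mult_vjoin [simp]: "(P ||| Q) *v vjoin x y = P *v x + Q *v y"
  by (simp add: vec_eq_iff matrix_vector_mult_def hcat_def vjoin_def sum_sum_type)

lemma vcat_mult [simp]: "vcat P Q *v x = vjoin (P *v x) (Q *v x)"
  by (auto simp: vec_eq_iff matrix_vector_mult_def vcat_def vjoin_def split: sum.splits)

lemma inner_transpose_mult: "x \<bullet> (transpose M *v y) = (M *v x) \<bullet> y" for M :: "real^'n^'m"
  by (metis dot_lmul_matrix inner_commute transpose_matrix_vector transpose_transpose)

text \<open>An off-diagonal block and its transpose contribute equally. Applied along the nesting,
  this turns a block LMI at a block vector into a scalar inequality; every LMI enters the proof in
  this way.\<close>

lemma sym_block_quadratic: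
  "vjoin x y \<bullet> (sym_block P Q R *v vjoin x y)
     = x \<bullet> (P *v x) + 2 * (x \<bullet> (Q *v y)) + y \<bullet> (R *v y)"
proof -
  have "y \<bullet> (transpose Q *v x) = x \<bullet> (Q *v y)"
    by (metis inner_transpose_mult inner_commute)
  then show ?thesis
    by (simp only: sym_block_def vcat_mult hcat_mult_vjoin inner_vjoin inner_add_right)
qed

lemma symmetric_mult_inner: "symmetric M \<Longrightarrow> (M *v x) \<bullet> y = x \<bullet> (M *v y)"
  by (metis inner_transpose_mult symmetric_def)

lemma symmetric_sym_block:
  assumes "symmetric P" "symmetric R"
  shows "symmetric (sym_block P Q R)"
proof -
  have "P $ i $ j = P $ j $ i" "R $ k $ l = R $ l $ k" for i j k l
    using assms by (metis (no_types) symmetric_def transpose_def vec_lambda_beta)+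
  then show ?thesis
    unfolding symmetric_def
    by (auto simp: sym_block_def vcat_def hcat_def transpose_def vec_eq_iff split: sum.splits)
qed

lemma matrix_inv_left: "invertible M \<Longrightarrow> matrix_inv M ** M = mat 1"
  and matrix_inv_right: "invertible M \<Longrightarrow> M ** matrix_inv M = mat 1"
  unfolding matrix_inv_def invertible_def by (metis (mono_tags, lifting) someI_ex)+

lemma invertible_iff_kernel:
  fixes M :: "'a::field^'n^'n"
  shows "invertible M \<longleftrightarrow> (\<forall>x. M *v x = 0 \<longrightarrow> x = 0)"
  by (simp add: invertible_left_inverse matrix_left_invertible_ker)

lemma positive_definite_invertible: "positive_definite M \<Longrightarrow> invertible M"
  unfolding positive_definite_def invertible_iff_kernel by (metis inner_zero_right less_irrefl)

text \<open>Real quadratic inequalities pass to complex vectors by adding up real and imaginary parts.\<close>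

definition vRe :: "complex^'n \<Rightarrow> real^'n" where "vRe x = (\<chi> i. Re (x $ i))"
definition vIm :: "complex^'n \<Rightarrow> real^'n" where "vIm x = (\<chi> i. Im (x $ i))"

lemma vRe_cmat [simp]: "vRe (cmat M *v x) = M *v vRe x"
  and vIm_cmat [simp]: "vIm (cmat M *v x) = M *v vIm x"
  by (simp_all add: vec_eq_iff vRe_def vIm_def cmat_def map_matrix_def matrix_vector_mult_def)

lemma vRe_add [simp]: "vRe (x + y) = vRe x + vRe y"
  and vIm_add [simp]: "vIm (x + y) = vIm x + vIm y"
  by (simp_all add: vec_eq_iff vRe_def vIm_def)

text \<open>On complex vectors \<open>\<bullet>\<close> is the real part of the Hermitian product,
  so it splits over real and imaginary parts, on which real matrices act separately.\<close>

lemma inner_vRe_vIm: "x \<bullet> y = vRe x \<bullet> vRe y + vIm x \<bullet> vIm y"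
  by (simp add: inner_vec_def vRe_def vIm_def inner_complex_def sum.distrib)

lemma vRe_vIm_eq_0: "vRe x = 0 \<Longrightarrow> vIm x = 0 \<Longrightarrow> x = 0"
  by (simp add: vec_eq_iff vRe_def vIm_def complex_eq_iff)

lemma ctranspose_cmat: "ctranspose (cmat M) = cmat (transpose M)"
  by (simp add: vec_eq_iff cmat_def map_matrix_def ctranspose_def transpose_def)

lemma ctranspose_mult: "ctranspose (M ** N) = ctranspose N ** ctranspose M"
  by (simp add: vec_eq_iff ctranspose_def map_matrix_def matrix_matrix_mult_def transpose_def mult.commute)

lemma ctranspose_add: "ctranspose (M + N) = ctranspose M + ctranspose N"
  by (simp add: vec_eq_iff ctranspose_def map_matrix_def transpose_def)

lemma ctranspose_diff: "ctranspose (M - N) = ctranspose M - ctranspose N"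
  by (simp add: vec_eq_iff ctranspose_def map_matrix_def transpose_def)

lemma ctranspose_mat: "ctranspose (mat z) = mat (cnj z)"
  by (auto simp: vec_eq_iff ctranspose_def map_matrix_def transpose_def mat_def)

lemma mat_mult_vector: "mat z *v x = z *s x" for x :: "'a::semiring_1^'n"
  by (simp add: vec_eq_iff mat_def matrix_vector_mult_def if_distrib if_distribR cong: if_cong)

lemma matrix_vector_mult_uminus: "(- M) *v x = - (M *v x)" for M :: "real^'n^'m"
  by (simp add: vec_eq_iff matrix_vector_mult_def sum_negf)

lemma matrix_mult_axis: "(M *v axis j 1) $ i = M $ i $ j" for M :: "complex^'n^'m"
  by (simp add: matrix_vector_mult_def axis_def if_distrib cong: if_cong)

lemma inner_ctranspose: "x \<bullet> (M *v y) = (ctranspose M *v x) \<bullet> y"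
proof -
  have "x \<bullet> (M *v y) = (\<Sum>i\<in>UNIV. \<Sum>j\<in>UNIV. x $ i \<bullet> (M $ i $ j * y $ j))"
    by (simp add: inner_vec_def matrix_vector_mult_def inner_sum_right)
  also have "\<dots> = (\<Sum>j\<in>UNIV. \<Sum>i\<in>UNIV. (cnj (M $ i $ j) * x $ i) \<bullet> y $ j)"
    by (subst sum.swap) (simp add: inner_complex_def algebra_simps)
  also have "\<dots> = (ctranspose M *v x) \<bullet> y"
    by (simp add: inner_vec_def matrix_vector_mult_def inner_sum_left ctranspose_def
        map_matrix_def transpose_def)
  finally show ?thesis .
qed

text \<open>For a phase \<open>c\<close> this makes storage functions invariant; for an eigenvalue
  it rescales them by the squared modulus.\<close>

lemma inner_smult_smult: "(c *s x) \<bullet> (c *s y) = (cmod c)\<^sup>2 * (x \<bullet> y)" for x y :: "complex^'n"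
proof -
  have "(c * a) \<bullet> (c * b) = (cmod c)\<^sup>2 * (a \<bullet> b)" for a b
    unfolding cmod_power2 inner_complex_def by (simp add: algebra_simps power2_eq_square)
  then show ?thesis
    by (simp add: inner_vec_def sum_distrib_left)
qed

lemma of_real_smult: "complex_of_real r *s x = r *\<^sub>R x" for x :: "complex^'n"
  by (simp add: vec_eq_iff scaleR_conv_of_real[where 'a=complex])

lemma matrix_vector_mult_smult: "M *v (z *s x) = z *s (M *v x)" for M :: "complex^'n^'m"
  by (simp add: vector_scalar_commute)

text \<open>The constant is the minimum of \<open>f\<close> on the compact unit sphere; homogeneity
  of degree two carries the bound to all vectors.\<close>

lemma positive_definite_coercive:
  fixes f :: "'a::euclidean_space \<Rightarrow> real"
  assumes cont: "continuous_on UNIV f" and hom: "\<And>c x. f (c *\<^sub>R x) = c\<^sup>2 * f x"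
    and pos: "\<And>x. x \<noteq> 0 \<Longrightarrow> 0 < f x"
  shows "\<exists>e>0. \<forall>x. e * (x \<bullet> x) \<le> f x"
proof -
  have "continuous_on (sphere 0 1) f"
    using cont continuous_on_subset by blast
  moreover have "sphere (0::'a) 1 \<noteq> {}" by simp
  ultimately obtain u where u: "u \<in> sphere 0 1" "\<And>x. x \<in> sphere 0 1 \<Longrightarrow> f u \<le> f x"
    using continuous_attains_inf[of "sphere (0::'a) 1" f] by auto
  have "f u * (x \<bullet> x) \<le> f x" for x
  proof (cases "x = 0")
    case True
    then show ?thesis using hom[of 0 x] by simp
  next
    case False
    have "f u \<le> f ((1 / norm x) *\<^sub>R x)"
      using False by (intro u(2)) simp
    also have "\<dots> = f x / (x \<bullet> x)"
      by (simp add: hom power_divide flip: power2_norm_eq_inner)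
    finally show ?thesis using False by (simp add: pos_le_divide_eq)
  qed
  moreover have "f u > 0" using u(1) pos[of u] by force
  ultimately show ?thesis by blast
qed

lemma schur_stable_invertible:
  assumes "schur_stable A" "cmod z = 1"
  shows "invertible (mat z - cmat A)"
  unfolding invertible_iff_kernel
proof (intro allI impI, rule ccontr)
  fix x assume "(mat z - cmat A) *v x = 0" "x \<noteq> 0"
  then have "is_eigenvalue (cmat A) z"
    unfolding is_eigenvalue_def
    by (intro exI[of _ x]) (simp add: matrix_vector_mult_diff_rdistrib mat_mult_vector)
  with assms show False by (force simp: schur_stable_def)
qed

text \<open>On an eigenvector the complexified form of \<open>P\<close> is multiplied by the squared
  modulus of the eigenvalue, and the decrease forces that factor below one.\<close>

lemma schur_stable_lyapunov:
  assumes "\<And>x. x \<noteq> 0 \<Longrightarrow> 0 < x \<bullet> (P *v x)"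
    and "\<And>x. x \<noteq> 0 \<Longrightarrow> (A *v x) \<bullet> (P *v (A *v x)) < x \<bullet> (P *v x)"
  shows "schur_stable A"
  unfolding schur_stable_def is_eigenvalue_def
proof (intro allI impI, elim exE conjE)
  fix c v assume v: "v \<noteq> 0" "cmat A *v v = c *s v"
  define q where "q x = x \<bullet> (cmat P *v x)" for x :: "complex^'a"
  have *: "0 < q v" "q (cmat A *v v) < q v"
  proof -
    \<comment> \<open>One strict inequality, from a nonzero part, and one weak inequality add up to
      a strict one.\<close>
    have "vRe v \<noteq> 0 \<or> vIm v \<noteq> 0" using v vRe_vIm_eq_0 by blast
    moreover have "0 \<le> x \<bullet> (P *v x)" "(A *v x) \<bullet> (P *v (A *v x)) \<le> x \<bullet> (P *v x)" for x
      using assms[of x] by (cases "x = 0"; force)+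
    ultimately show "0 < q v" "q (cmat A *v v) < q v"
      using assms[of "vRe v"] assms[of "vIm v"]
      unfolding q_def inner_vRe_vIm vRe_cmat vIm_cmat
      by (metis add_pos_nonneg add_nonneg_pos, metis add_less_le_mono add_le_less_mono)
  qed
  have "q (c *s v) = (cmod c)\<^sup>2 * q v"
    by (simp add: q_def matrix_vector_mult_smult inner_smult_smult)
  with * v have "(cmod c)\<^sup>2 < 1" by simp
  then show "cmod c < 1" by (simp add: abs_square_less_1)
qed

subsection \<open>Singular values and continuity of transfer functions\<close>

text \<open>Finiteness gives the \<open>Max\<close> in \<open>sigma_max\<close> its meaning.
  Eigenvectors of the self-adjoint \<open>ctranspose M ** M\<close> for different eigenvalues are
  orthogonal, hence independent, hence finitely many.\<close>

lemma finite_singular_values: "finite (singular_values M)" for M :: "complex^'n^'m"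
proof -
  let ?N = "ctranspose M ** M"
  have "\<forall>s\<in>singular_values M. \<exists>v. v \<noteq> 0 \<and> ?N *v v = (s\<^sup>2) *\<^sub>R v"
    unfolding singular_values_def is_eigenvalue_def of_real_smult by blast
  then obtain v where v: "\<And>s. s \<in> singular_values M \<Longrightarrow> v s \<noteq> 0"
    "\<And>s. s \<in> singular_values M \<Longrightarrow> ?N *v v s = (s\<^sup>2) *\<^sub>R v s"
    by metis
  have orth: "v s \<bullet> v t = 0" if "s \<in> singular_values M" "t \<in> singular_values M" "s \<noteq> t" for s t
  proof -
    have "t\<^sup>2 * (v s \<bullet> v t) = v s \<bullet> (?N *v v t)" using v(2)[OF that(2)] by simp
    also have "\<dots> = (M *v v s) \<bullet> (M *v v t)"
      by (metis inner_ctranspose inner_commute matrix_vector_mul_assoc)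
    also have "\<dots> = (?N *v v s) \<bullet> v t"
      by (metis inner_ctranspose matrix_vector_mul_assoc)
    also have "\<dots> = s\<^sup>2 * (v s \<bullet> v t)" using v(2)[OF that(1)] by simp
    finally have "(t\<^sup>2 - s\<^sup>2) * (v s \<bullet> v t) = 0" by (simp add: algebra_simps)
    moreover have "t\<^sup>2 \<noteq> s\<^sup>2" using that by (auto simp: singular_values_def)
    ultimately show ?thesis by simp
  qed
  then have "inj_on v (singular_values M)"
    using v(1) by (metis inj_onI inner_eq_zero_iff)
  moreover have "independent (v ` singular_values M)"
  proof (rule pairwise_orthogonal_independent)
    show "pairwise orthogonal (v ` singular_values M)"
      using orth by (fastforce simp: pairwise_def orthogonal_def)
    show "0 \<notin> v ` singular_values M" using v(1) by auto
  qed
  ultimately show ?thesis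
    using independent_imp_finite finite_imageD by blast
qed

text \<open>No singular value exceeds the operator norm, and the operator norm is one: a maximiser
  \<open>u\<close> of the norm of \<open>M *v x\<close> on the unit sphere is an eigenvector of
  \<open>ctranspose M ** M\<close>.\<close>

lemma sigma_max_eq_onorm: "sigma_max M = onorm ((*v) M)" for M :: "complex^'n^'m"
proof -
  let ?n = "onorm ((*v) M)"
  let ?N = "ctranspose M ** M"
  have bl: "bounded_linear ((*v) M)" by simp
  have quad: "x \<bullet> (?N *v y) = (M *v x) \<bullet> (M *v y)" for x y
    by (metis inner_ctranspose inner_commute matrix_vector_mul_assoc)
  have upper: "s \<le> ?n" if s: "s \<in> singular_values M" for s
  proof -
    obtain v where v: "v \<noteq> 0" "?N *v v = complex_of_real (s\<^sup>2) *s v" and "0 \<le> s"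
      using s by (auto simp: singular_values_def is_eigenvalue_def)
    have "?N *v v = (s\<^sup>2) *\<^sub>R v"
      using v(2) unfolding of_real_smult .
    then have "(norm (M *v v))\<^sup>2 = (s * norm v)\<^sup>2"
      using quad[of v v] by (simp add: power2_norm_eq_inner power_mult_distrib)
    then have "norm (M *v v) = s * norm v" using \<open>0 \<le> s\<close> by simp
    then have "s * norm v \<le> ?n * norm v" using onorm[OF bl, of v] by simp
    then show "s \<le> ?n" using v by simp
  qed
  have "?n \<in> singular_values M"
  proof -
    have "continuous_on (sphere 0 1) (\<lambda>x. norm (M *v x))"
      by (intro continuous_intros linear_continuous_on bl)
    moreover have "sphere (0::complex^'n) 1 \<noteq> {}" by simp
    ultimately obtain u where u: "norm u = 1" "\<And>x. norm x = 1 \<Longrightarrow> norm (M *v x) \<le> norm (M *v u)"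
      using continuous_attains_sup[of "sphere (0::complex^'n) 1" "\<lambda>x. norm (M *v x)"] by auto
    have le: "norm (M *v x) \<le> norm (M *v u) * norm x" for x
    proof (cases "x = 0")
      case False
      have "norm (M *v ((1 / norm x) *\<^sub>R x)) \<le> norm (M *v u)"
        using False by (intro u(2)) simp
      with False show ?thesis by (simp add: linear_cmul field_simps)
    qed simp
    have n: "?n = norm (M *v u)"
      using onorm_bound[OF _ le] onorm[OF bl, of u] u(1) by (intro antisym) auto
    \<comment> \<open>\<open>w\<close> is the residual of the eigenvector equation for
      \<open>u\<close>; the aim is \<open>b = 0\<close>.\<close>
    define w where "w = (?n\<^sup>2) *\<^sub>R u - ?N *v u"
    define b where "b = w \<bullet> w"
    define c where "c = ?n\<^sup>2 * (w \<bullet> w) - (M *v w) \<bullet> (M *v w)"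
    have c: "0 \<le> c"
      using le[of w] unfolding c_def n
      by (metis diff_ge_0_iff_ge norm_ge_zero power2_norm_eq_inner power_mono power_mult_distrib)
    \<comment> \<open>The form
      \<open>?n\<^sup>2 * (x \<bullet> x) - (M *v x) \<bullet> (M *v x)\<close> is nonnegative and
      vanishes at \<open>u\<close>; this is its expansion along
      \<open>u + t *\<^sub>R w\<close>.\<close>
    have var: "0 \<le> 2 * t * b + t\<^sup>2 * c" for t
    proof -
      let ?x = "u + t *\<^sub>R w"
      have "(M *v ?x) \<bullet> (M *v ?x) \<le> ?n\<^sup>2 * (?x \<bullet> ?x)"
        using le[of ?x] unfolding n
        by (metis norm_ge_zero power2_norm_eq_inner power_mono power_mult_distrib)
      moreover have "(M *v u) \<bullet> (M *v u) = ?n\<^sup>2 * (u \<bullet> u)"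
        using u(1) by (simp add: n flip: power2_norm_eq_inner)
      moreover have beq: "b = ?n\<^sup>2 * (w \<bullet> u) - (M *v w) \<bullet> (M *v u)"
        unfolding b_def by (subst (2) w_def) (simp add: inner_diff_right quad)
      moreover have "M *v ?x = M *v u + t *\<^sub>R (M *v w)"
        by (simp add: matrix_vector_right_distrib linear_cmul)
      ultimately show ?thesis
        unfolding beq c_def
        by (simp add: inner_add_left inner_add_right inner_commute[of u w]
            inner_commute[of "M *v u" "M *v w"] power2_eq_square algebra_simps)
    qed
    have "b = 0"
    proof (rule ccontr)
      assume "b \<noteq> 0"
      \<comment> \<open>At \<open>t = - b / (c + 1)\<close> the linear term dominates and the
        expansion is negative; the added one keeps the denominator positive when
        \<open>c = 0\<close>.\<close>
      then have "0 < b\<^sup>2 * (c + 2) / (c + 1)\<^sup>2" using c by simp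
      moreover have "2 * (- b / (c + 1)) * b + (- b / (c + 1))\<^sup>2 * c = - (b\<^sup>2 * (c + 2) / (c + 1)\<^sup>2)"
        using c by (simp add: divide_simps) (simp add: power2_eq_square algebra_simps)
      ultimately show False using var[of "- b / (c + 1)"] by linarith
    qed
    then have "?N *v u = (?n\<^sup>2) *\<^sub>R u" by (simp add: b_def w_def)
    moreover have "(?n\<^sup>2) *\<^sub>R u = complex_of_real (?n\<^sup>2) *s u"
      unfolding of_real_smult ..
    moreover have "u \<noteq> 0" using u(1) by auto
    ultimately show ?thesis
      unfolding singular_values_def is_eigenvalue_def using onorm_pos_le[OF bl] by auto
  qed
  then show ?thesis
    unfolding sigma_max_def using upper by (intro Max_eqI finite_singular_values)
qed

text \<open>The triangle inequality makes the operator norm Lipschitz in the matrix. Continuity then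
  gives the measurability that bounding the essential supremum requires.\<close>

lemma continuous_on_sigma_max: "continuous_on UNIV (sigma_max :: complex^'n^'m \<Rightarrow> real)"
proof -
  have "bilinear ((*v) :: complex^'n^'m \<Rightarrow> _)"
    unfolding bilinear_def
    by (auto intro!: linearI simp: vec_eq_iff matrix_vector_mult_def sum.distrib algebra_simps scaleR_sum_right)
  then have "bounded_bilinear ((*v) :: complex^'n^'m \<Rightarrow> _)"
    by (simp add: bilinear_conv_bounded_bilinear)
  then obtain K where K: "0 \<le> K" "\<And>(M :: complex^'n^'m) x. norm (M *v x) \<le> norm M * norm x * K"
    using bounded_bilinear.nonneg_bounded by blast
  have step: "sigma_max M - sigma_max N \<le> K * dist M N" for M N :: "complex^'n^'m"
  proof -
    have "(*v) M = (\<lambda>x. N *v x + (M - N) *v x)"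
      by (auto simp: matrix_vector_mult_diff_rdistrib)
    then have "onorm ((*v) M) \<le> onorm ((*v) N) + onorm ((*v) (M - N))"
      using onorm_triangle[of "(*v) N" "(*v) (M - N)"] by simp
    moreover have "onorm ((*v) (M - N)) \<le> K * norm (M - N)"
      using K by (intro onorm_bound) (auto simp: mult_ac)
    ultimately show ?thesis by (simp add: sigma_max_eq_onorm dist_norm)
  qed
  have "dist (sigma_max M) (sigma_max N) \<le> K * dist M N" for M N :: "complex^'n^'m"
    using step[of M N] step[of N M] by (simp add: dist_real_def abs_le_iff dist_commute)
  then have "K-lipschitz_on UNIV (sigma_max :: complex^'n^'m \<Rightarrow> real)"
    using K(1) by (intro lipschitz_onI)
  then show ?thesis by (rule lipschitz_on_continuous_on)
qed

section \<open>Continuity in the frequency\<close>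

lemma continuous_on_matrix_mult:
  fixes f :: "'a::topological_space \<Rightarrow> complex^'n^'m" and g :: "'a \<Rightarrow> complex^'k^'n"
  assumes "continuous_on S f" "continuous_on S g"
  shows "continuous_on S (\<lambda>x. f x ** g x)"
  unfolding matrix_matrix_mult_def
  using assms by (intro continuous_on_vec_lambda continuous_intros) auto

lemma continuous_on_det:
  fixes f :: "'a::topological_space \<Rightarrow> complex^'n^'n"
  assumes "continuous_on S f"
  shows "continuous_on S (\<lambda>x. det (f x))"
  unfolding det_def using assms by (intro continuous_intros) auto

lemma continuous_on_matrix_inv:
  fixes f :: "'a::topological_space \<Rightarrow> complex^'n^'n"
  assumes f: "continuous_on S f" and inv: "\<And>x. x \<in> S \<Longrightarrow> invertible (f x)"
  shows "continuous_on S (\<lambda>x. matrix_inv (f x))"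
proof -
  \<comment> \<open>By Cramer's rule, entry \<open>k\<close> of the solution with right side
    \<open>axis l 1\<close>, that is, of column \<open>l\<close> of the inverse.\<close>
  let ?c = "\<lambda>k l x. det (\<chi> i j. if j = k then axis l 1 $ i else f x $ i $ j) / det (f x)"
  have cramer_inv: "matrix_inv (f x) = (\<chi> k l. ?c k l x)" if "x \<in> S" for x
  proof -
    have "det (f x) \<noteq> 0" using inv[OF that] by (simp add: invertible_det_nz)
    moreover have "f x *v (matrix_inv (f x) *v axis l 1) = axis l 1" for l
      using inv[OF that] by (simp add: matrix_vector_mul_assoc matrix_inv_right)
    ultimately have "matrix_inv (f x) *v axis l 1 = (\<chi> k. ?c k l x)" for l
      using cramer by blast
    then have "(matrix_inv (f x) *v axis l 1) $ k = ?c k l x" for k l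
      by simp
    moreover have "(matrix_inv (f x) *v axis l 1) $ k = matrix_inv (f x) $ k $ l" for k l
      by (rule matrix_mult_axis)
    ultimately show ?thesis by (simp add: vec_eq_iff)
  qed
  have "continuous_on S (\<lambda>x. \<chi> k l. ?c k l x)"
  proof (intro continuous_on_vec_lambda continuous_on_divide continuous_on_det f)
    show "\<forall>x\<in>S. det (f x) \<noteq> 0" using inv by (simp add: invertible_det_nz)
    show "continuous_on S (\<lambda>x. if j = k then axis l 1 $ i else f x $ i $ j)" for i j k l
      using f by (cases "j = k") (auto intro!: continuous_intros)
  qed
  then show ?thesis
    by (subst continuous_on_cong[OF refl cramer_inv])
qed

lemma continuous_on_resolvent:
  assumes "schur_stable A"
  shows "continuous_on UNIV (\<lambda>\<omega>. matrix_inv (mat (cis \<omega>) - cmat A))"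
proof (rule continuous_on_matrix_inv)
  show "continuous_on UNIV (\<lambda>\<omega>. mat (cis \<omega>) - cmat A)"
    unfolding mat_def
  proof (intro continuous_intros continuous_on_vec_lambda)
    show "continuous_on UNIV (\<lambda>x. if i = j then cis x else 0)" for i j :: 'a
      by (cases "i = j") (auto intro!: continuous_intros)
  qed
qed (use schur_stable_invertible[OF assms] in simp)

lemma continuous_on_transfer:
  assumes "schur_stable A"
  shows "continuous_on UNIV (\<lambda>\<omega>. transfer A B C D (cis \<omega>))"
  unfolding transfer_def
  by (intro continuous_intros continuous_on_matrix_mult continuous_on_resolvent assms)

lemma hinf_norm_bounds:
  assumes cont: "continuous_on UNIV (\<lambda>\<omega>. g (cis \<omega>))"
    and c: "0 \<le> c" "\<And>\<omega> w. norm (g (cis \<omega>) *v w) \<le> c * norm w"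
  shows "0 \<le> hinf_norm g" "hinf_norm g \<le> ereal c"
proof -
  let ?M = "restrict_space lborel {-pi..<pi}"
  have meas: "(\<lambda>\<omega>. ereal (sigma_max (g (cis \<omega>)))) \<in> borel_measurable ?M"
  proof (intro borel_measurable_ereal measurable_restrict_space1)
    have "continuous_on UNIV (\<lambda>\<omega>. sigma_max (g (cis \<omega>)))"
      using continuous_on_compose2[OF continuous_on_sigma_max cont] by simp
    then show "(\<lambda>\<omega>. sigma_max (g (cis \<omega>))) \<in> borel_measurable lborel"
      by (simp add: borel_measurable_continuous_onI)
  qed
  have "sigma_max (g (cis \<omega>)) \<le> c" for \<omega>
    unfolding sigma_max_eq_onorm using c by (intro onorm_bound)
  then show "hinf_norm g \<le> ereal c"
    unfolding hinf_norm_def using meas by (intro esssup_I) auto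
  \<comment> \<open>The interval has positive length, which keeps the essential supremum of the zero
    function from being \<open>-\<infinity>\<close>.\<close>
  have "emeasure ?M (space ?M) = ennreal (2 * pi)"
    by (simp add: emeasure_restrict_space space_restrict_space)
  then have "esssup ?M (\<lambda>_. 0 :: ereal) = 0"
    by (intro esssup_const) simp
  moreover have "esssup ?M (\<lambda>_. 0 :: ereal) \<le> hinf_norm g"
    unfolding hinf_norm_def
    by (intro esssup_mono) (auto simp: sigma_max_eq_onorm onorm_pos_le)
  ultimately show "0 \<le> hinf_norm g" by simp
qed

subsection \<open>Mean of the resolvent and duality\<close>

lemma continuous_on_smult:
  fixes f :: "'a::topological_space \<Rightarrow> complex" and g :: "'a \<Rightarrow> complex^'n"
  assumes "continuous_on S f" "continuous_on S g"
  shows "continuous_on S (\<lambda>x. f x *s g x)"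
  unfolding vector_scalar_mult_def using assms
  by (intro continuous_on_vec_lambda continuous_intros) auto

lemma bounded_linear_smult_left: "bounded_linear (\<lambda>z. z *s c)" for c :: "complex^'n"
  unfolding linear_conv_bounded_linear[symmetric]
  by (auto intro!: linearI simp: vec_eq_iff algebra_simps)

lemma has_integral_cis:
  assumes "k > 0"
  shows "((\<lambda>\<omega>. cis (real k * \<omega>)) has_integral 0) {-pi..pi}"
proof -
  let ?F = "\<lambda>\<omega>. cis (real k * \<omega>) / (\<i> * k)"
  have "(?F has_vector_derivative cis (real k * \<omega>)) (at \<omega> within {-pi..pi})" for \<omega>
    unfolding has_vector_derivative_def using assms
    by (auto intro!: derivative_eq_intros simp: fun_eq_iff scaleR_conv_of_real field_simps)
  then have "((\<lambda>\<omega>. cis (real k * \<omega>)) has_integral (?F pi - ?F (-pi))) {-pi..pi}"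
    by (intro fundamental_theorem_of_calculus) auto
  moreover have "?F pi = ?F (-pi)"
    by (simp add: complex_eq_iff Re_divide Im_divide)
  ultimately show ?thesis by simp
qed

text \<open>The Fourier coefficients \<open>m k\<close> satisfy \<open>m k = M (m (k + 1))\<close>, and powers of \<open>M\<close> tend to zero.\<close>

lemma resolvent_mean_zero:
  fixes M :: "complex^'n^'n" and \<eta> :: "real \<Rightarrow> complex^'n"
  assumes cont: "continuous_on UNIV \<eta>"
    and eq: "\<And>\<omega>. \<eta> \<omega> = cis \<omega> *s (M *v \<eta> \<omega> + c)"
    and e: "e > 0" "\<And>x. e * (x \<bullet> x) \<le> q x" and K: "\<And>x. q x \<le> K * (x \<bullet> x)"
    and r: "0 \<le> r" "r < 1" "\<And>x. q (M *v x) \<le> r * q x"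
  shows "integral {-pi..pi} \<eta> = 0"
proof -
  define h where "h k \<omega> = cis (real k * \<omega>) *s \<eta> \<omega>" for k \<omega>
  define m where "m k = integral {-pi..pi} (h k)" for k
  have conth: "continuous_on {-pi..pi} (h k)" for k
    unfolding h_def
    by (intro continuous_on_smult continuous_intros continuous_on_subset[OF cont]) auto
  have has_m: "(h k has_integral m k) {-pi..pi}" for k
    unfolding m_def by (intro integrable_integral integrable_continuous_real conth)
  \<comment> \<open>Multiplying the equation for \<open>\<eta>\<close> by
    \<open>cis (real k * \<omega>)\<close> raises the frequency by one, so the constant
    \<open>c\<close> is paired with the positive frequency \<open>Suc k\<close> and integrates to
    zero.\<close>
  have rec: "m k = M *v m (Suc k)" for k
  proof -
    have "((\<lambda>\<omega>. M *v h (Suc k) \<omega>) has_integral M *v m (Suc k)) {-pi..pi}"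
      using has_integral_linear[OF has_m matrix_vector_mul_bounded_linear] by (simp add: o_def)
    moreover have "((\<lambda>\<omega>. cis (real (Suc k) * \<omega>) *s c) has_integral 0 *s c) {-pi..pi}"
      using has_integral_linear[OF has_integral_cis bounded_linear_smult_left]
      unfolding o_def by blast
    ultimately have "((\<lambda>\<omega>. M *v h (Suc k) \<omega> + cis (real (Suc k) * \<omega>) *s c) has_integral
        M *v m (Suc k) + 0 *s c) {-pi..pi}"
      by (rule has_integral_add)
    moreover have "M *v h (Suc k) \<omega> + cis (real (Suc k) * \<omega>) *s c = h k \<omega>" for \<omega>
    proof -
      have "h k \<omega> = cis (real k * \<omega>) *s (cis \<omega> *s (M *v \<eta> \<omega> + c))"
        using eq[of \<omega>] by (simp add: h_def)
      also have "\<dots> = cis (real (Suc k) * \<omega>) *s (M *v \<eta> \<omega> + c)"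
        by (simp add: cis_mult algebra_simps)
      finally show ?thesis
        by (simp add: h_def matrix_vector_mult_smult vector_add_ldistrib)
    qed
    ultimately have "(h k has_integral M *v m (Suc k)) {-pi..pi}"
      by (simp only: vector_smult_lzero add_0_right)
    then show ?thesis
      using has_m[of k] has_integral_unique by blast
  qed
  have "compact (\<eta> ` {-pi..pi})"
    by (intro compact_continuous_image continuous_on_subset[OF cont]) auto
  then obtain b where b: "\<And>\<omega>. \<omega> \<in> {-pi..pi} \<Longrightarrow> norm (\<eta> \<omega>) \<le> b"
    using compact_imp_bounded bounded_iff by (metis imageI)
  have m_bound: "norm (m k) \<le> b * (pi - - pi)" for k
    unfolding m_def
  proof (rule integral_bound)
    fix \<omega> assume "\<omega> \<in> {-pi..pi}"
    have "(norm (h k \<omega>))\<^sup>2 = (norm (\<eta> \<omega>))\<^sup>2"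
      by (simp add: h_def power2_norm_eq_inner inner_smult_smult)
    then show "norm (h k \<omega>) \<le> b" using b[OF \<open>\<omega> \<in> _\<close>] by simp
  qed (use conth in auto)
  have qpos: "0 \<le> q x" for x
    using e(1) e(2)[of x] by (meson inner_ge_zero mult_nonneg_nonneg order_trans less_imp_le)
  have "0 \<le> K"
    using K[of "axis undefined 1"] qpos[of "axis undefined 1"] by (simp add: inner_axis_axis)
  let ?B = "K * (b * (pi - - pi))\<^sup>2"
  have qm: "q (m k) \<le> ?B" for k
  proof -
    have "m k \<bullet> m k \<le> (b * (pi - - pi))\<^sup>2"
      using power_mono[OF m_bound[of k] norm_ge_zero, of 2] by (simp add: power2_norm_eq_inner)
    with K[of "m k"] \<open>0 \<le> K\<close> show ?thesis by (meson mult_left_mono order_trans)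
  qed
  \<comment> \<open>Going up in \<open>k\<close> gains a factor \<open>r\<close> each time, while
    \<open>q (m k)\<close> stays below \<open>?B\<close>; letting \<open>k\<close> tend to infinity
    forces \<open>m 0 = 0\<close>.\<close>
  have iter: "q (m 0) \<le> r ^ k * q (m k)" for k
  proof (induction k)
    case (Suc k)
    have "r ^ k * q (m k) \<le> r ^ k * (r * q (m (Suc k)))"
      using r(1,3) by (subst rec) (intro mult_left_mono; simp)
    with Suc show ?case by (simp add: mult_ac)
  qed simp
  have "q (m 0) \<le> r ^ k * ?B" for k
    using iter[of k] qm[of k] r(1) by (meson mult_left_mono order_trans zero_le_power)
  moreover have "(\<lambda>k. r ^ k * ?B) \<longlonglongrightarrow> 0"
    using LIMSEQ_realpow_zero[OF r(1,2)] tendsto_mult_left_zero by blast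
  ultimately have "q (m 0) \<le> 0"
    by (intro LIMSEQ_le_const) auto
  then have "e * (m 0 \<bullet> m 0) \<le> 0" using e(2)[of "m 0"] by linarith
  then have "m 0 \<bullet> m 0 \<le> 0"
    using e(1) by (simp add: mult_le_0_iff del: inner_eq_zero_iff)
  then have "m 0 = 0"
    by (metis inner_gt_zero_iff not_less)
  moreover have "h 0 = \<eta>" by (simp add: h_def fun_eq_iff)
  ultimately show ?thesis by (simp add: m_def)
qed

text \<open>Both sides are the squared Frobenius norm. Summing by rows of \<open>G\<close> brings in
  the adjoint, to which the dual inequalities apply.\<close>

lemma re_trace_ctranspose_mult:
  "Re (trace (ctranspose G ** G)) = (\<Sum>i\<in>UNIV. (norm (ctranspose G *v axis i 1))\<^sup>2)"
  for G :: "complex^'u^'p"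
proof -
  have "Re (trace (ctranspose G ** G)) = (\<Sum>j\<in>UNIV. \<Sum>i\<in>UNIV. (cmod (G $ i $ j))\<^sup>2)"
    by (simp add: trace_def matrix_matrix_mult_def ctranspose_def transpose_def map_matrix_def
        cmod_power2 flip: power2_eq_square)
  also have "\<dots> = (\<Sum>i\<in>UNIV. \<Sum>j\<in>UNIV. (cmod (G $ i $ j))\<^sup>2)"
    by (rule sum.swap)
  also have "\<dots> = (\<Sum>i\<in>UNIV. (norm (ctranspose G *v axis i 1))\<^sup>2)"
    by (simp add: norm_vec_def L2_set_def sum_nonneg matrix_mult_axis)
       (simp add: ctranspose_def transpose_def map_matrix_def)
  finally show ?thesis .
qed

text \<open>With \<open>Q\<close> the inverse of \<open>P\<close>, the dissipation inequality of the system in the storage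
  function \<open>P\<close> becomes that of the transposed system in the storage function \<open>Q\<close>.\<close>

lemma dual_dissipation:
  fixes A P :: "real^'n^'n" and B :: "real^'w^'n" and C :: "real^'n^'z" and D :: "real^'w^'z"
  assumes P: "positive_definite P"
    and diss: "\<And>x w. (A *v x + B *v w) \<bullet> (P *v (A *v x + B *v w)) \<le> x \<bullet> (P *v x) + w \<bullet> w"
    and strict: "\<And>x. x \<noteq> 0 \<Longrightarrow> (A *v x) \<bullet> (P *v (A *v x)) < x \<bullet> (P *v x)"
    and out: "\<And>a x w. 0 \<le> a \<bullet> (W *v a) + 2 * (a \<bullet> (C *v x + D *v w)) + x \<bullet> (P *v x) + w \<bullet> w"
  obtains Q where
    "\<And>y. y \<noteq> 0 \<Longrightarrow> 0 < y \<bullet> (Q *v y)" "symmetric Q"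
    "\<And>y. (transpose A *v y) \<bullet> (Q *v (transpose A *v y)) +
        (transpose B *v y) \<bullet> (transpose B *v y) \<le> y \<bullet> (Q *v y)"
    "\<And>y. y \<noteq> 0 \<Longrightarrow> (transpose A *v y) \<bullet> (Q *v (transpose A *v y)) < y \<bullet> (Q *v y)"
    "\<And>a. (transpose C *v a) \<bullet> (Q *v (transpose C *v a)) +
        (transpose D *v a) \<bullet> (transpose D *v a) \<le> a \<bullet> (W *v a)"
proof
  define Q where "Q = matrix_inv P"
  have symP: "x \<bullet> (P *v y) = (P *v x) \<bullet> y" for x y
    using P symmetric_mult_inner unfolding positive_definite_def by metis
  have nnP: "0 \<le> x \<bullet> (P *v x)" for x
    using P by (cases "x = 0") (auto simp: positive_definite_def intro: less_imp_le)
  have PQ: "P *v (Q *v x) = x" "Q *v (P *v x) = x" for x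
    using positive_definite_invertible[OF P]
    by (simp_all add: Q_def matrix_vector_mul_assoc matrix_inv_left matrix_inv_right)
  have Qquad: "y \<bullet> (Q *v y) = (Q *v y) \<bullet> (P *v (Q *v y))" for y
    by (simp add: PQ inner_commute)
  \<comment> \<open>Fenchel-Young inequality: the forms of \<open>P\<close> and of its inverse are
    convex conjugates up to scaling.\<close>
  have fenchel: "2 * (y \<bullet> x) \<le> y \<bullet> (Q *v y) + x \<bullet> (P *v x)" for x y
  proof -
    have "0 \<le> (x - Q *v y) \<bullet> (P *v (x - Q *v y))" by (rule nnP)
    also have "\<dots> = x \<bullet> (P *v x) - 2 * (y \<bullet> x) + y \<bullet> (Q *v y)"
      using symP[of "Q *v y" x]
      by (simp add: matrix_vector_mult_diff_distrib inner_diff_left inner_diff_right PQ inner_commute)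
    finally show ?thesis by simp
  qed
  have adj: "y \<bullet> (M *v x) = (transpose M *v y) \<bullet> x" for M :: "real^'a^'b" and x y
    by (metis inner_commute inner_transpose_mult)
  have neg: "M *v (- x) = - (M *v x)" for M :: "real^'a^'b" and x
    by (simp add: linear_neg[OF matrix_vector_mul_linear])
  have "x \<bullet> (Q *v y) = (Q *v x) \<bullet> y" for x y
    by (metis PQ(1) symP)
  then show "symmetric Q"
    by (metis adj inner_commute matrix_eq symmetric_def vector_eq_rdot)
  show pos: "0 < y \<bullet> (Q *v y)" if "y \<noteq> 0" for y
  proof -
    have "Q *v y \<noteq> 0" using that PQ(1)[of y] by auto
    then show ?thesis using P unfolding Qquad positive_definite_def by blast
  qed
  show "(transpose A *v y) \<bullet> (Q *v (transpose A *v y)) + (transpose B *v y) \<bullet> (transpose B *v y)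
      \<le> y \<bullet> (Q *v y)" for y
  proof -
    \<comment> \<open>With this state and input, the pairing of \<open>y\<close> with the next state
      is the left side of the goal, and so is the supplied bound in \<open>diss\<close>. Fenchel
      thus gives twice the left side on one hand, and the right side plus the left side on the
      other.\<close>
    let ?x = "Q *v (transpose A *v y)" and ?w = "transpose B *v y"
    have "y \<bullet> (A *v ?x + B *v ?w) = (transpose A *v y) \<bullet> ?x + ?w \<bullet> ?w"
      by (simp only: inner_add_right adj[of y A] adj[of y B])
    then show ?thesis
      using fenchel[of y "A *v ?x + B *v ?w"] diss[of ?x ?w] Qquad[of "transpose A *v y"] by linarith
  qed
  show "(transpose A *v y) \<bullet> (Q *v (transpose A *v y)) < y \<bullet> (Q *v y)" if "y \<noteq> 0" for y
  \<comment> \<open>If the test state vanishes, \<open>strict\<close> says nothing, but then the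
    left side is zero and \<open>pos\<close> suffices.\<close>
  proof (cases "Q *v (transpose A *v y) = 0")
    case True
    then show ?thesis using pos[OF that] by (simp only: inner_zero_right)
  next
    case False
    let ?x = "Q *v (transpose A *v y)"
    have "y \<bullet> (A *v ?x) = (transpose A *v y) \<bullet> ?x"
      by (rule adj)
    then show ?thesis
      using fenchel[of y "A *v ?x"] strict[OF False] Qquad[of "transpose A *v y"] by linarith
  qed
  show "(transpose C *v a) \<bullet> (Q *v (transpose C *v a)) + (transpose D *v a) \<bullet> (transpose D *v a)
      \<le> a \<bullet> (W *v a)" for a
  proof -
    \<comment> \<open>The negatives of \<open>?x\<close> and \<open>?w\<close> minimise the
      expression in \<open>out\<close> for fixed \<open>a\<close>.\<close>
    let ?x = "Q *v (transpose C *v a)" and ?w = "transpose D *v a"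
    have "a \<bullet> (C *v (- ?x) + D *v (- ?w)) = - ((transpose C *v a) \<bullet> ?x) - ?w \<bullet> ?w"
      by (simp only: inner_add_right adj[of a C] adj[of a D] inner_minus_right diff_conv_add_uminus)
    moreover have "(- ?x) \<bullet> (P *v (- ?x)) = ?x \<bullet> (P *v ?x)"
      by (simp only: neg inner_minus_right inner_minus_left minus_minus)
    moreover have "(- ?w) \<bullet> (- ?w) = ?w \<bullet> ?w"
      by (simp only: inner_minus_right inner_minus_left minus_minus)
    ultimately show ?thesis
      using out[of a "- ?x" "- ?w"] Qquad[of "transpose C *v a"] by linarith
  qed
qed

subsection \<open>Norm bounds from dissipation inequalities\<close>

lemma continuous_on_ctranspose:
  "continuous_on S f \<Longrightarrow> continuous_on S (\<lambda>x. ctranspose (f x))"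
  unfolding ctranspose_def transpose_def map_matrix_def
  by (intro continuous_on_vec_lambda) (simp add: continuous_intros)

lemma continuous_on_matrix_vector_mult:
  fixes f :: "'a::topological_space \<Rightarrow> complex^'n^'m"
  assumes "continuous_on S f"
  shows "continuous_on S (\<lambda>x. f x *v v)"
  unfolding matrix_vector_mult_def
  using assms by (intro continuous_on_vec_lambda continuous_intros) auto

lemma resolvent_eq:
  assumes "schur_stable A" "cmod z = 1"
  shows "z *s (matrix_inv (mat z - cmat A) *v b) = cmat A *v (matrix_inv (mat z - cmat A) *v b) + b"
proof -
  have "(mat z - cmat A) *v (matrix_inv (mat z - cmat A) *v b) = b"
    by (simp add: matrix_vector_mul_assoc matrix_inv_right schur_stable_invertible[OF assms])
  then show ?thesis
    by (simp add: matrix_vector_mult_diff_rdistrib mat_mult_vector algebra_simps)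
qed

text \<open>The adjoint resolvent equation contains \<open>cnj z\<close>; multiplying by
  \<open>z\<close>, with \<open>z * cnj z = 1\<close>, yields the fixed-point form used in
  \<open>resolvent_mean_zero\<close>.\<close>

lemma resolvent_ctranspose_eq:
  assumes "schur_stable A" "cmod z = 1" and \<eta>: "\<eta> = ctranspose (matrix_inv (mat z - cmat A)) *v c"
  shows "\<eta> = z *s (cmat (transpose A) *v \<eta> + c)"
proof -
  let ?R = "matrix_inv (mat z - cmat A)"
  have "ctranspose (?R ** (mat z - cmat A)) = mat 1"
    by (simp add: matrix_inv_left schur_stable_invertible[OF assms(1,2)] ctranspose_mat)
  then have "(mat (cnj z) - cmat (transpose A)) ** ctranspose ?R = mat 1"
    by (simp only: ctranspose_mult ctranspose_diff ctranspose_mat ctranspose_cmat)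
  then have "(mat (cnj z) - cmat (transpose A)) *v \<eta> = c"
    by (simp add: \<eta> matrix_vector_mul_assoc)
  then have "cnj z *s \<eta> = cmat (transpose A) *v \<eta> + c"
    by (simp add: matrix_vector_mult_diff_rdistrib mat_mult_vector algebra_simps)
  moreover have "z *s (cnj z *s \<eta>) = \<eta>"
    using assms(2) by (simp flip: complex_norm_square)
  ultimately show ?thesis by simp
qed

lemma hinf_norm_le:
  fixes A X :: "real^'n^'n" and B :: "real^'u^'n" and C :: "real^'n^'p" and D :: "real^'u^'p"
  assumes stab: "schur_stable A" and \<gamma>: "0 < \<gamma>"
    and diss: "\<And>x w. (A *v x + B *v w) \<bullet> (X *v (A *v x + B *v w)) +
        (C *v x + D *v w) \<bullet> (C *v x + D *v w) / \<gamma> \<le> x \<bullet> (X *v x) + w \<bullet> w"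
  shows "0 \<le> hinf_norm (transfer A B C D)" "hinf_norm (transfer A B C D) \<le> ereal (sqrt \<gamma>)"
proof -
  have bound: "norm (transfer A B C D (cis \<omega>) *v w) \<le> sqrt \<gamma> * norm w" for \<omega> w
  proof -
    let ?z = "cis \<omega>" and ?q = "\<lambda>x. x \<bullet> (cmat X *v x)"
    define x where "x = matrix_inv (mat ?z - cmat A) *v (cmat B *v w)"
    define y where "y = cmat C *v x + cmat D *v w"
    have zx: "?z *s x = cmat A *v x + cmat B *v w"
      unfolding x_def using stab by (intro resolvent_eq) auto
    have y: "transfer A B C D ?z *v w = y"
      by (simp add: transfer_def y_def x_def matrix_vector_mult_add_rdistrib matrix_vector_mul_assoc matrix_mul_assoc)
    have "?q (cmat A *v x + cmat B *v w) + y \<bullet> y / \<gamma> \<le> ?q x + w \<bullet> w"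
      using diss[of "vRe x" "vRe w"] diss[of "vIm x" "vIm w"]
      by (simp add: inner_vRe_vIm[where 'a='u] inner_vRe_vIm[where 'a='n] inner_vRe_vIm[where 'a='p]
          y_def add_divide_distrib)
    \<comment> \<open>The next state is \<open>?z *s x\<close>, so the storage terms cancel and only
      output and input remain.\<close>
    moreover have "?q (cmat A *v x + cmat B *v w) = ?q x"
      by (simp add: matrix_vector_mult_smult inner_smult_smult flip: zx)
    ultimately have "y \<bullet> y \<le> \<gamma> * (w \<bullet> w)" using \<gamma> by (simp add: field_simps)
    then have "sqrt ((norm y)\<^sup>2) \<le> sqrt (\<gamma> * (norm w)\<^sup>2)"
      by (simp only: power2_norm_eq_inner real_sqrt_le_iff)
    then show ?thesis by (simp add: y real_sqrt_mult)
  qed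
  note * = hinf_norm_bounds[OF continuous_on_transfer[OF stab] _ bound]
  show "0 \<le> hinf_norm (transfer A B C D)" "hinf_norm (transfer A B C D) \<le> ereal (sqrt \<gamma>)"
    using \<gamma> by (intro *; simp)+
qed

text \<open>Row \<open>i\<close> of the transfer function has squared norm at most
  \<open>W $ i $ i\<close> on average over the circle; adding the rows gives the trace.\<close>

lemma h2_norm_le:
  fixes A P :: "real^'n^'n" and B :: "real^'u^'n" and C :: "real^'n^'p" and D :: "real^'u^'p"
  assumes P: "positive_definite P"
    and diss: "\<And>x w. (A *v x + B *v w) \<bullet> (P *v (A *v x + B *v w)) \<le> x \<bullet> (P *v x) + w \<bullet> w"
    and strict: "\<And>x. x \<noteq> 0 \<Longrightarrow> (A *v x) \<bullet> (P *v (A *v x)) < x \<bullet> (P *v x)"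
    and out: "\<And>a x w. 0 \<le> a \<bullet> (W *v a) + 2 * (a \<bullet> (C *v x + D *v w)) + x \<bullet> (P *v x) + w \<bullet> w"
  shows "(h2_norm (transfer A B C D))\<^sup>2 \<le> trace W"
proof -
  have stab: "schur_stable A"
    using P strict by (intro schur_stable_lyapunov[of P]) (auto simp: positive_definite_def)
  obtain Q where Qpos: "\<And>y. y \<noteq> 0 \<Longrightarrow> 0 < y \<bullet> (Q *v y)" and symQ: "symmetric Q"
    and dissQ: "\<And>y. (transpose A *v y) \<bullet> (Q *v (transpose A *v y)) +
        (transpose B *v y) \<bullet> (transpose B *v y) \<le> y \<bullet> (Q *v y)"
    and strictQ: "\<And>y. y \<noteq> 0 \<Longrightarrow> (transpose A *v y) \<bullet> (Q *v (transpose A *v y)) < y \<bullet> (Q *v y)"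
    and outQ: "\<And>a. (transpose C *v a) \<bullet> (Q *v (transpose C *v a)) +
        (transpose D *v a) \<bullet> (transpose D *v a) \<le> a \<bullet> (W *v a)"
    using dual_dissipation[OF P diss strict out] by metis
  define At Bt Ct Dt where "At = cmat (transpose A)" and "Bt = cmat (transpose B)"
    and "Ct = cmat (transpose C)" and "Dt = cmat (transpose D)"
  define q where "q x = x \<bullet> (cmat Q *v x)" for x
  have dissq: "q (At *v y) + (Bt *v y) \<bullet> (Bt *v y) \<le> q y" for y
    unfolding q_def At_def Bt_def inner_vRe_vIm vRe_cmat vIm_cmat
    using dissQ[of "vRe y"] dissQ[of "vIm y"] by linarith
  have outq: "q (Ct *v a) + (Dt *v a) \<bullet> (Dt *v a) \<le> a \<bullet> (cmat W *v a)" for a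
    unfolding q_def Ct_def Dt_def inner_vRe_vIm vRe_cmat vIm_cmat
    using outQ[of "vRe a"] outQ[of "vIm a"] by linarith
  have contQ: "continuous_on UNIV (\<lambda>x. (M *v x) \<bullet> (Q *v (M *v x)))" for M :: "real^'n^'n"
    unfolding matrix_vector_mul_assoc
    by (intro continuous_on_inner linear_continuous_on matrix_vector_mul_bounded_linear)
  obtain e where e: "e > 0" "\<And>x. e * (x \<bullet> x) \<le> x \<bullet> (Q *v x)"
    using positive_definite_coercive[of "\<lambda>x. x \<bullet> (Q *v x)"] Qpos contQ[of "mat 1"]
    by (force simp: linear_cmul power2_eq_square matrix_vector_mult_scaleR)
  obtain d where d: "d > 0"
    "\<And>x. d * (x \<bullet> x) \<le> x \<bullet> (Q *v x) - (transpose A *v x) \<bullet> (Q *v (transpose A *v x))"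
  proof -
    have "\<exists>d>0. \<forall>x. d * (x \<bullet> x) \<le> x \<bullet> (Q *v x) - (transpose A *v x) \<bullet> (Q *v (transpose A *v x))"
    proof (rule positive_definite_coercive)
      show "continuous_on UNIV (\<lambda>x. x \<bullet> (Q *v x) - (transpose A *v x) \<bullet> (Q *v (transpose A *v x)))"
        using continuous_on_diff[OF contQ[of "mat 1"] contQ[of "transpose A"]] by simp
    qed (use strictQ in \<open>auto simp: matrix_vector_mult_scaleR power2_eq_square algebra_simps simp del: transpose_matrix_vector\<close>)
    then show ?thesis using that by blast
  qed
  have eq: "e * (x \<bullet> x) \<le> q x" for x
    unfolding q_def inner_vRe_vIm vRe_cmat vIm_cmat
    using e(2)[of "vRe x"] e(2)[of "vIm x"] by (simp add: distrib_left)
  have dq: "d * (x \<bullet> x) \<le> q x - q (At *v x)" for x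
    unfolding q_def At_def inner_vRe_vIm vRe_cmat vIm_cmat
    using d(2)[of "vRe x"] d(2)[of "vIm x"] by (simp only: distrib_left)
  \<comment> \<open>The maximum with \<open>d\<close> ensures \<open>d \<le> K\<close>, hence
    \<open>0 \<le> r\<close> for the contraction factor \<open>r = 1 - d / K\<close>: a decrease by
    \<open>d * (x \<bullet> x)\<close> is at least the fraction \<open>d / K\<close> of
    \<open>q x\<close>.\<close>
  define K where "K = max d (onorm ((*v) (cmat Q)))"
  have K: "q x \<le> K * (x \<bullet> x)" for x
  proof -
    have "q x \<le> norm x * norm (cmat Q *v x)"
      unfolding q_def by (rule norm_cauchy_schwarz)
    also have "\<dots> \<le> norm x * (onorm ((*v) (cmat Q)) * norm x)"
      by (intro mult_left_mono onorm) auto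
    also have "\<dots> \<le> K * (x \<bullet> x)"
      by (auto simp: K_def dot_square_norm power2_eq_square mult_ac intro!: mult_left_mono)
    finally show ?thesis .
  qed
  define r where "r = 1 - d / K"
  have "d \<le> K" "0 < K" using d(1) by (auto simp: K_def)
  have r: "0 \<le> r" "r < 1" "q (At *v x) \<le> r * q x" for x
  proof -
    show "0 \<le> r" "r < 1" using \<open>d \<le> K\<close> \<open>0 < K\<close> d(1) by (auto simp: r_def)
    have "d / K * q x \<le> d / K * (K * (x \<bullet> x))"
      using K[of x] d(1) \<open>0 < K\<close> by (intro mult_left_mono) auto
    then show "q (At *v x) \<le> r * q x"
      using dq[of x] \<open>0 < K\<close> by (simp add: r_def algebra_simps)
  qed
  define R where "R \<omega> = matrix_inv (mat (cis \<omega>) - cmat A)" for \<omega>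
  define \<eta> where "\<eta> i \<omega> = ctranspose (R \<omega>) *v (Ct *v axis i 1)" for i \<omega>
  \<comment> \<open>Coefficient of the terms linear in \<open>\<eta>\<close>: the cross terms from
    \<open>q\<close> and from the input channel, moved off \<open>\<eta>\<close> by
    transposition.\<close>
  define k where "k i = cmat A *v (cmat Q *v (Ct *v axis i 1)) + cmat B *v (Dt *v axis i 1)" for i
  have \<eta>_cont: "continuous_on UNIV (\<eta> i)" for i
    unfolding \<eta>_def R_def
    by (intro continuous_on_matrix_vector_mult continuous_on_ctranspose continuous_on_resolvent stab)
  have \<eta>_eq: "\<eta> i \<omega> = cis \<omega> *s (At *v \<eta> i \<omega> + Ct *v axis i 1)" for i \<omega>
    unfolding At_def using stab
    by (intro resolvent_ctranspose_eq) (simp_all add: \<eta>_def R_def)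
  have \<eta>_mean: "(\<eta> i has_integral 0) {-pi..pi}" for i
    using resolvent_mean_zero[OF \<eta>_cont \<eta>_eq e(1) eq K r(1,2,3)]
      integrable_continuous_real[OF continuous_on_subset[OF \<eta>_cont]]
    by (metis has_integral_iff subset_UNIV)
  define g where "g \<omega> = transfer A B C D (cis \<omega>)" for \<omega>
  have g_ctranspose: "ctranspose (g \<omega>) *v axis i 1 = Bt *v \<eta> i \<omega> + Dt *v axis i 1" for i \<omega>
    unfolding g_def transfer_def \<eta>_def R_def Bt_def Ct_def Dt_def
    by (simp only: ctranspose_add ctranspose_mult ctranspose_cmat matrix_vector_mult_add_rdistrib
        matrix_vector_mul_assoc)
  have pointwise: "(norm (ctranspose (g \<omega>) *v axis i 1))\<^sup>2 \<le> W $ i $ i + 2 * (\<eta> i \<omega> \<bullet> k i)" for i \<omega>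
  proof -
    let ?y = "\<eta> i \<omega>" and ?c = "Ct *v axis i 1" and ?d = "Dt *v axis i 1"
    \<comment> \<open>The unimodular factor drops out of \<open>q\<close>. Expanding the square and
      cancelling \<open>q (At *v ?y)\<close> against \<open>dissq\<close> leaves only terms linear
      in \<open>?y\<close> and constants.\<close>
    have "q ?y = q (cis \<omega> *s (At *v ?y + ?c))"
      using \<eta>_eq[of i \<omega>] by simp
    also have "\<dots> = q (At *v ?y + ?c)"
      by (simp only: q_def matrix_vector_mult_smult inner_smult_smult norm_cis power_one mult_1)
    also have "\<dots> = q (At *v ?y) + 2 * ((At *v ?y) \<bullet> (cmat Q *v ?c)) + q ?c"
    proof -
      have "?c \<bullet> (cmat Q *v (At *v ?y)) = (At *v ?y) \<bullet> (cmat Q *v ?c)"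
        using symQ by (metis ctranspose_cmat inner_commute inner_ctranspose symmetric_def)
      then show ?thesis
        by (simp add: q_def matrix_vector_right_distrib inner_add_left inner_add_right)
    qed
    finally have "(Bt *v ?y) \<bullet> (Bt *v ?y) \<le> 2 * ((At *v ?y) \<bullet> (cmat Q *v ?c)) + q ?c"
      using dissq[of ?y] by linarith
    moreover have "(axis i 1 :: complex^'p) \<bullet> (cmat W *v axis i 1) = W $ i $ i"
      by (simp add: inner_axis' matrix_mult_axis) (simp add: inner_complex_def cmat_def map_matrix_def)
    moreover have "?y \<bullet> k i = (At *v ?y) \<bullet> (cmat Q *v ?c) + (Bt *v ?y) \<bullet> ?d"
      by (simp only: k_def inner_add_right inner_ctranspose[of ?y] ctranspose_cmat At_def Bt_def)
    moreover have "(norm (Bt *v ?y + ?d))\<^sup>2 = (Bt *v ?y) \<bullet> (Bt *v ?y) + 2 * ((Bt *v ?y) \<bullet> ?d) + ?d \<bullet> ?d"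
      by (simp add: power2_norm_eq_inner inner_add_left inner_add_right inner_commute)
    ultimately show ?thesis
      unfolding g_ctranspose using outq[of "axis i 1"] by simp
  qed
  define \<phi> where "\<phi> \<omega> = Re (trace (ctranspose (g \<omega>) ** g \<omega>))" for \<omega>
  have \<phi>_eq: "\<phi> \<omega> = (\<Sum>i\<in>UNIV. (norm (ctranspose (g \<omega>) *v axis i 1))\<^sup>2)" for \<omega>
    unfolding \<phi>_def by (rule re_trace_ctranspose_mult)
  have \<phi>_cont: "continuous_on {-pi..pi} \<phi>"
    unfolding \<phi>_eq[abs_def] g_def
    by (intro continuous_intros continuous_on_matrix_vector_mult continuous_on_ctranspose
        continuous_on_subset[OF continuous_on_transfer[OF stab]]) auto
  have "((\<lambda>\<omega>. \<Sum>i\<in>UNIV. W $ i $ i + 2 * (\<eta> i \<omega> \<bullet> k i)) has_integral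
      (\<Sum>i\<in>UNIV. 2 * pi * W $ i $ i)) {-pi..pi}"
  proof (rule has_integral_sum)
    fix i
    have "bounded_linear (\<lambda>x. 2 * (x \<bullet> k i))"
      by (intro bounded_linear_intros)
    from has_integral_linear[OF \<eta>_mean this]
    have "((\<lambda>\<omega>. 2 * (\<eta> i \<omega> \<bullet> k i)) has_integral 0) {-pi..pi}" by (simp add: o_def)
    from has_integral_add[OF has_integral_const_real this]
    show "((\<lambda>\<omega>. W $ i $ i + 2 * (\<eta> i \<omega> \<bullet> k i)) has_integral 2 * pi * W $ i $ i) {-pi..pi}"
      by simp
  qed simp
  then have \<psi>_int: "((\<lambda>\<omega>. \<Sum>i\<in>UNIV. W $ i $ i + 2 * (\<eta> i \<omega> \<bullet> k i)) has_integral 2 * pi * trace W) {-pi..pi}"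
    by (simp only: trace_def sum_distrib_left)
  have \<phi>_int: "(\<phi> has_integral integral {-pi..pi} \<phi>) {-pi..pi}"
    using \<phi>_cont by (intro integrable_integral integrable_continuous_real)
  have upper: "integral {-pi..pi} \<phi> \<le> 2 * pi * trace W"
    using \<phi>_int \<psi>_int by (rule has_integral_le) (auto simp: \<phi>_eq intro!: sum_mono pointwise)
  \<comment> \<open>Nonnegativity lets the square undo the square root in
    \<open>h2_norm\<close>.\<close>
  have "0 \<le> integral {-pi..pi} \<phi>"
    using \<phi>_int by (rule has_integral_nonneg) (simp add: \<phi>_eq sum_nonneg)
  moreover have "(LBINT \<omega>:{-pi..pi}. \<phi> \<omega>) = integral {-pi..pi} \<phi>"
    using \<phi>_cont by (intro set_borel_integral_eq_integral borel_integrable_atLeastAtMost')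
  ultimately have "(h2_norm (transfer A B C D))\<^sup>2 = 1 / (2 * pi) * integral {-pi..pi} \<phi>"
    unfolding h2_norm_def by (simp flip: \<phi>_def g_def)
  also have "\<dots> \<le> 1 / (2 * pi) * (2 * pi * trace W)"
    using upper by (intro mult_left_mono) auto
  finally show ?thesis by simp
qed

subsection \<open>The recovered filter\<close>

text \<open>\<open>S\<close> stands for \<open>Z\<^sup>-\<^sup>1 U\<^sup>-\<^sup>T\<close> and
  \<open>J\<close> for \<open>V\<^sup>-\<^sup>1\<close>; the condition on \<open>J\<close> is what
  remains of the factorization once \<open>U\<close> and \<open>V\<close> are eliminated.\<close>

lemma recovered_filter_admissible:
  fixes A :: "real^'n^'n" and B :: "real^'w^'n" and C :: "real^'n^'y" and D :: "real^'w^'y"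
    and L :: "real^'n^'z" and T :: "real^'n^'n"
    and W :: "real^'z^'z" and Y Z :: "real^'n^'n"
    and Fh :: "real^'n^'n" and Gh :: "real^'y^'n" and Hh :: "real^'n^'z" and Kh :: "real^'y^'z"
  assumes "\<rho> > 0" and symY: "symmetric Y" and symZ: "symmetric Z" and "trace W < \<mu>"
    and lmi1: "positive_definite
      (sym_block W (L - Kh ** C - Hh ||| L - Kh ** C ||| - (Kh ** D))
      (sym_block Z (Z                ||| (0 :: real^'w^'n))
      (sym_block Y (0 :: real^'w^'n)
                 (mat 1 :: real^'w^'w))))"
    and lmi2: "positive_definite
      (sym_block Z (Z ||| (0 :: real^'z^'n) ||| (0 :: real^'n^'n) ||| (0 :: real^'n^'n) ||| (0 :: real^'n^'n))
      (sym_block Y (      (0 :: real^'z^'n) ||| Fh                ||| (0 :: real^'n^'n) ||| Gh ** C ** T)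
      (sym_block (mat (lam / \<rho>\<^sup>2) :: real^'z^'z)
                   (                            Hh                ||| (0 :: real^'n^'z) ||| Kh ** C ** T)
      (sym_block Z (                                                  Z                 ||| (0 :: real^'n^'n))
      (sym_block Y (0 :: real^'n^'n)
                 (mat 1 :: real^'n^'n))))))"
    and lmi3: "positive_definite
      (sym_block Z (Z ||| Z ** A                    ||| Z ** A               ||| Z ** B)
      (sym_block Y (      Y ** A + Gh ** C + Fh     ||| Y ** A + Gh ** C     ||| Y ** B + Gh ** D)
      (sym_block Z (                                    Z                    ||| (0 :: real^'w^'n))
      (sym_block Y (0 :: real^'w^'n)
                 (mat 1 :: real^'w^'w)))))"
    and S: "invertible S" and J: "\<And>y. (Y - Z) *v (S *v (J *v y)) = - y"
  shows "admissible_filter A B C D L T \<mu> lam \<rho> (J ** Fh ** S) (J ** Gh) (Hh ** S) Kh"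
proof -
  define X where "X = Y - Z"
  define F where "F = J ** Fh ** S"
  define G where "G = J ** Gh"
  define H where "H = Hh ** S"
  define p where "p x \<xi> = x \<bullet> (Z *v x) + (x - \<xi>) \<bullet> (X *v (x - \<xi>))" for x \<xi>
  have Y_eq: "Y *v x = Z *v x + X *v x" for x
    by (simp add: X_def matrix_vector_mult_diff_rdistrib)
  have ZX: "x \<bullet> (Z *v y) = y \<bullet> (Z *v x)" "x \<bullet> (X *v y) = y \<bullet> (X *v x)" for x y
    using symmetric_mult_inner[OF symZ, of y x] symmetric_mult_inner[OF symY, of y x]
    by (simp_all add: X_def matrix_vector_mult_diff_rdistrib inner_diff_right inner_commute)
  \<comment> \<open>The same storage function in the coordinates \<open>\<xi>\<close> and
    \<open>x - \<xi>\<close>, where its matrix is the block with entries \<open>Z\<close>,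
    \<open>Z\<close>, \<open>Z\<close>, \<open>Y\<close> that recurs in the LMIs.\<close>
  have p_eq: "p x \<xi> = \<xi> \<bullet> (Z *v \<xi>) + 2 * (\<xi> \<bullet> (Z *v (x - \<xi>))) + (x - \<xi>) \<bullet> (Y *v (x - \<xi>))" for x \<xi>
    unfolding p_def Y_eq
    by (simp add: matrix_vector_mult_diff_distrib inner_diff_left inner_diff_right inner_add_right ZX(1)[of x \<xi>])

  \<comment> \<open>The three LMIs as dissipation inequalities\<close>
  have err_out: "0 < a \<bullet> (W *v a) + 2 * (a \<bullet> (L *v x - Kh *v (C *v x + D *v w) - Hh *v \<xi>)) + p x \<xi> + w \<bullet> w"
    if "a \<noteq> 0 \<or> x \<noteq> 0 \<or> \<xi> \<noteq> 0 \<or> w \<noteq> 0" for a x \<xi> w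
  proof -
    have "vjoin a (vjoin \<xi> (vjoin (x - \<xi>) w)) \<noteq> 0"
      using that by auto
    from lmi1[unfolded positive_definite_def, THEN conjunct2, rule_format, OF this] show ?thesis
      by (simp add: sym_block_quadratic p_eq matrix_vector_mult_diff_rdistrib matrix_vector_mult_diff_distrib
          matrix_vector_right_distrib inner_add_right inner_diff_right
          matrix_vector_mult_uminus flip: matrix_vector_mul_assoc)
  qed
  have p_pos: "0 < p x \<xi>" if "x \<noteq> 0 \<or> \<xi> \<noteq> 0" for x \<xi>
    using err_out[of 0 x \<xi> 0] that by simp
  have X_pos: "0 < x \<bullet> (X *v x)" if "x \<noteq> 0" for x
    using p_pos[of 0 x] that by (simp add: p_def linear_neg)

  have plant: "p (A *v x + B *v w) \<xi>' < p x \<xi> + w \<bullet> w"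
    if ne: "x \<noteq> 0 \<or> \<xi> \<noteq> 0 \<or> w \<noteq> 0" and \<xi>': "X *v \<xi>' = - (Fh *v \<xi> + Gh *v (C *v x + D *v w))" for x \<xi> \<xi>' w
  proof -
    define u where "u = A *v x + B *v w"
    \<comment> \<open>The first two entries are minus the coordinates \<open>\<xi>'\<close> and
      \<open>u - \<xi>'\<close> of the next state. The cross terms amount to
      \<open>- 2 * p u \<xi>'\<close> and the leading block to \<open>p u \<xi>'\<close>, as in a
      Schur complement.\<close>
    have "vjoin (- \<xi>') (vjoin (\<xi>' - u) (vjoin \<xi> (vjoin (x - \<xi>) w))) \<noteq> 0"
      using ne by auto
    from lmi3[unfolded positive_definite_def, THEN conjunct2, rule_format, OF this]
    have "0 < (- \<xi>') \<bullet> (Z *v (- \<xi>')) + 2 * ((- \<xi>') \<bullet> (Z *v (\<xi>' - u))) + (\<xi>' - u) \<bullet> (Y *v (\<xi>' - u))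
      + 2 * ((- \<xi>') \<bullet> (Z *v u)) + 2 * ((\<xi>' - u) \<bullet> (Y *v u + (Fh *v \<xi> + Gh *v (C *v x + D *v w))))
      + p x \<xi> + w \<bullet> w"
      by (simp add: sym_block_quadratic p_eq u_def matrix_vector_mult_add_rdistrib matrix_vector_mult_diff_distrib
          matrix_vector_right_distrib inner_add_right inner_diff_right inner_diff_left algebra_simps
          flip: matrix_vector_mul_assoc)
    also have "Fh *v \<xi> + Gh *v (C *v x + D *v w) = - (X *v \<xi>')"
      using \<xi>' by simp
    finally show ?thesis
      unfolding u_def[symmetric] p_def[of u] Y_eq
      by (simp add: linear_neg matrix_vector_mult_diff_distrib inner_add_right inner_diff_right inner_diff_left
          ZX(1)[of u \<xi>'] ZX(2)[of u \<xi>'])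
  qed

  define \<gamma> where "\<gamma> = lam / \<rho>\<^sup>2"
  have privacy: "0 < \<gamma> * (s \<bullet> s) + 2 * (s \<bullet> (Hh *v \<xi> + Kh *v (C *v (T *v v)))) - \<xi>' \<bullet> (X *v \<xi>')
      + \<xi> \<bullet> (X *v \<xi>) + v \<bullet> v"
    if ne: "s \<noteq> 0 \<or> \<xi> \<noteq> 0 \<or> v \<noteq> 0" and \<xi>': "X *v \<xi>' = - (Fh *v \<xi> + Gh *v (C *v (T *v v)))" for s \<xi> \<xi>' v
  proof -
    \<comment> \<open>Opposite entries correspond to plant state zero and reduce both blocks with
      entries \<open>Z\<close>, \<open>Z\<close>, \<open>Z\<close>, \<open>Y\<close> to
      \<open>X\<close>. The cross term with \<open>Fh\<close> and \<open>Gh\<close> contributes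
      minus twice the leading block.\<close>
    have "vjoin (- \<xi>') (vjoin \<xi>' (vjoin s (vjoin \<xi> (vjoin (- \<xi>) v)))) \<noteq> 0"
      using ne by auto
    from lmi2[unfolded positive_definite_def, THEN conjunct2, rule_format, OF this]
    have "0 < \<xi>' \<bullet> (X *v \<xi>') + 2 * (\<xi>' \<bullet> (Fh *v \<xi> + Gh *v (C *v (T *v v)))) + \<gamma> * (s \<bullet> s)
      + 2 * (s \<bullet> (Hh *v \<xi> + Kh *v (C *v (T *v v)))) + \<xi> \<bullet> (X *v \<xi>) + v \<bullet> v"
      by (simp add: sym_block_quadratic X_def \<gamma>_def linear_neg mat_mult_vector scalar_mult_eq_scaleR
          matrix_vector_mult_diff_rdistrib inner_add_right inner_diff_right
          flip: matrix_vector_mul_assoc)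
    also have "Fh *v \<xi> + Gh *v (C *v (T *v v)) = - (X *v \<xi>')"
      using \<xi>' by simp
    finally show ?thesis by simp
  qed
  have \<gamma>: "0 < \<gamma>"
  proof -
    have "axis undefined 1 \<noteq> (0 :: real^'z)" by simp
    with privacy[of "axis undefined 1" 0 0 0] show ?thesis by (simp add: inner_axis_axis)
  qed

  \<comment> \<open>Return to the original filter state, stability and the
    \<open>H\<infinity>\<close> bound\<close>
  have S_ne: "S *v h \<noteq> 0" if "h \<noteq> 0" for h
    using S that invertible_iff_kernel by blast
  have Fh: "F *v h = J *v (Fh *v (S *v h))" and Gy: "G *v y = J *v (Gh *v y)"
    and Hh: "H *v h = Hh *v (S *v h)" for h y
    by (simp_all add: F_def G_def H_def matrix_vector_mul_assoc matrix_mul_assoc)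
  have J': "X *v (S *v (J *v y)) = - y" for y
    using J by (simp add: X_def)

  define XS where "XS = transpose S ** X ** S"
  have XS: "h \<bullet> (XS *v h) = (S *v h) \<bullet> (X *v (S *v h))" for h
    unfolding XS_def by (simp only: inner_transpose_mult flip: matrix_vector_mul_assoc)
  have privS: "(F *v h + (G ** C ** T) *v v) \<bullet> (XS *v (F *v h + (G ** C ** T) *v v)) +
      (H *v h + (Kh ** C ** T) *v v) \<bullet> (H *v h + (Kh ** C ** T) *v v) / \<gamma> < h \<bullet> (XS *v h) + v \<bullet> v"
    if "h \<noteq> 0 \<or> v \<noteq> 0" for h v
  proof -
    define e where "e = Hh *v (S *v h) + Kh *v (C *v (T *v v))"
    define \<xi>' where "\<xi>' = S *v (F *v h + (G ** C ** T) *v v)"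
    have "X *v \<xi>' = - (Fh *v (S *v h) + Gh *v (C *v (T *v v)))"
      by (simp add: \<xi>'_def Fh Gy matrix_vector_right_distrib J' flip: matrix_vector_mul_assoc)
    \<comment> \<open>The choice \<open>s = - e / \<gamma>\<close> minimises
      \<open>\<gamma> * (s \<bullet> s) + 2 * (s \<bullet> e)\<close>, with value
      \<open>- (e \<bullet> e / \<gamma>)\<close>.\<close>
    then have "0 < \<gamma> * ((- (1 / \<gamma>) *\<^sub>R e) \<bullet> (- (1 / \<gamma>) *\<^sub>R e)) + 2 * ((- (1 / \<gamma>) *\<^sub>R e) \<bullet> e)
        - \<xi>' \<bullet> (X *v \<xi>') + (S *v h) \<bullet> (X *v (S *v h)) + v \<bullet> v"
      unfolding e_def using that S_ne by (intro privacy) auto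
    moreover have "\<gamma> * ((- (1 / \<gamma>) *\<^sub>R e) \<bullet> (- (1 / \<gamma>) *\<^sub>R e)) + 2 * ((- (1 / \<gamma>) *\<^sub>R e) \<bullet> e) = - (e \<bullet> e / \<gamma>)"
      using \<gamma> by (simp add: field_simps)
    moreover have "H *v h + (Kh ** C ** T) *v v = e"
      by (simp add: e_def Hh flip: matrix_vector_mul_assoc)
    ultimately show ?thesis
      unfolding XS \<xi>'_def[symmetric] by simp
  qed
  have stabF: "schur_stable F"
  proof (rule schur_stable_lyapunov[of XS])
    show "0 < h \<bullet> (XS *v h)" if "h \<noteq> 0" for h
      unfolding XS using X_pos S_ne[OF that] by blast
    show "(F *v h) \<bullet> (XS *v (F *v h)) < h \<bullet> (XS *v h)" if "h \<noteq> 0" for h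
    proof -
      \<comment> \<open>At zero input the second LMI is a strict Lyapunov inequality once the output
        term is dropped.\<close>
      have "0 \<le> (H *v h) \<bullet> (H *v h) / \<gamma>" using \<gamma> by simp
      with privS[of h 0] that show ?thesis by simp
    qed
  qed
  have hinf: "ereal (\<rho>\<^sup>2) * (hinf_norm (transfer F (G ** C ** T) H (Kh ** C ** T)))\<^sup>2 \<le> ereal lam"
  proof -
    have "(F *v h + (G ** C ** T) *v v) \<bullet> (XS *v (F *v h + (G ** C ** T) *v v)) +
      (H *v h + (Kh ** C ** T) *v v) \<bullet> (H *v h + (Kh ** C ** T) *v v) / \<gamma> \<le> h \<bullet> (XS *v h) + v \<bullet> v" for h v
      using privS[of h v] by (cases "h = 0 \<and> v = 0") auto
    note * = hinf_norm_le[OF stabF \<gamma> this]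
    then obtain r where r: "hinf_norm (transfer F (G ** C ** T) H (Kh ** C ** T)) = ereal r" "0 \<le> r" "r \<le> sqrt \<gamma>"
      by (cases "hinf_norm (transfer F (G ** C ** T) H (Kh ** C ** T))") auto
    have "r\<^sup>2 \<le> \<gamma>" using r \<gamma> power_mono[of r "sqrt \<gamma>" 2] by simp
    then show ?thesis
      using \<open>\<rho> > 0\<close> by (simp add: r \<gamma>_def field_simps)
  qed

  \<comment> \<open>The combined dynamics and the \<open>H2\<close> bound\<close>
  define P where "P = sym_block Y (- (X ** S)) XS"
  \<comment> \<open>Expanding \<open>p x (S *v h)\<close>, with \<open>Z + X = Y\<close> in the
    square of \<open>x\<close>, gives the blocks of \<open>P\<close>.\<close>
  have P_quad: "vjoin x h \<bullet> (P *v vjoin x h) = p x (S *v h)" for x h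
  proof -
    have "(- (X ** S)) *v h = - (X *v (S *v h))"
      by (simp add: matrix_vector_mult_uminus flip: matrix_vector_mul_assoc)
    then show ?thesis
      unfolding P_def sym_block_quadratic XS p_def Y_eq
      by (simp add: matrix_vector_mult_diff_distrib inner_diff_left inner_diff_right inner_add_right
          ZX(2)[of x "S *v h"])
  qed
  have symX: "symmetric X" using symY symZ by (simp add: X_def symmetric_def transpose_def vec_eq_iff)
  have P_pd: "positive_definite P"
    unfolding positive_definite_def
  proof (intro conjI allI impI)
    have "symmetric XS"
      using symX by (simp add: XS_def symmetric_def matrix_transpose_mul matrix_mul_assoc)
    with symY show "symmetric P" unfolding P_def by (rule symmetric_sym_block)
    fix v :: "real^('n + 'n)" assume "v \<noteq> 0"
    moreover obtain x h where "v = vjoin x h" using vjoin_surj by blast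
    ultimately show "0 < v \<bullet> (P *v v)"
      using p_pos[of x "S *v h"] S_ne by (auto simp: P_quad)
  qed
  let ?A = "err_A A C F G" and ?B = "err_B B D G" and ?C = "err_C C L H Kh" and ?D = "err_D D Kh"
  have step: "?A *v vjoin x h + ?B *v w
      = vjoin (A *v x + B *v w) (F *v h + G *v (C *v x + D *v w))" for x h w
    by (simp add: err_A_def err_B_def vjoin_add matrix_vector_right_distrib algebra_simps
        flip: matrix_vector_mul_assoc)
  have diss: "(?A *v v + ?B *v w) \<bullet> (P *v (?A *v v + ?B *v w)) < v \<bullet> (P *v v) + w \<bullet> w"
    if "v \<noteq> 0 \<or> w \<noteq> 0" for v w
  proof -
    obtain x h where v: "v = vjoin x h" using vjoin_surj by blast
    have "X *v (S *v (F *v h + G *v (C *v x + D *v w))) = - (Fh *v (S *v h) + Gh *v (C *v x + D *v w))"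
      by (simp add: Fh Gy matrix_vector_right_distrib J')
    then show ?thesis
      unfolding v step P_quad using that S_ne by (intro plant) (auto simp: v)
  qed
  have "(h2_norm (transfer ?A ?B ?C ?D))\<^sup>2 \<le> trace W"
  proof (rule h2_norm_le[OF P_pd])
    show "(?A *v v + ?B *v w) \<bullet> (P *v (?A *v v + ?B *v w)) \<le> v \<bullet> (P *v v) + w \<bullet> w" for v w
      using diss[of v w] by (cases "v = 0 \<and> w = 0") auto
    show "(?A *v v) \<bullet> (P *v (?A *v v)) < v \<bullet> (P *v v)" if "v \<noteq> 0" for v
      using diss[of v 0] that by simp
    show "0 \<le> a \<bullet> (W *v a) + 2 * (a \<bullet> (?C *v v + ?D *v w)) + v \<bullet> (P *v v) + w \<bullet> w" for a v w
    proof -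
      obtain x h where v: "v = vjoin x h" using vjoin_surj by blast
      have "?C *v v + ?D *v w = L *v x - Kh *v (C *v x + D *v w) - Hh *v (S *v h)"
        by (simp add: v err_C_def err_D_def matrix_vector_mult_uminus Hh matrix_vector_mult_diff_rdistrib matrix_vector_right_distrib
            flip: matrix_vector_mul_assoc)
      then show ?thesis
        using err_out[of a x "S *v h" w]
        by (cases "a = 0 \<and> x = 0 \<and> S *v h = 0 \<and> w = 0") (auto simp: v P_quad p_def)
    qed
  qed
  with stabF hinf \<open>trace W < \<mu>\<close> show ?thesis
    unfolding admissible_filter_def err_transfer_def by (simp add: F_def G_def H_def)
qed

text \<open>The second conjunct keeps the recovery claim from being vacuous; together with the third
  it yields the first.\<close>

theorem theorem5:
  fixes A :: "real^'n^'n" and B :: "real^'w^'n" and C :: "real^'n^'y" and D :: "real^'w^'y"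
    and L :: "real^'n^'z" and T :: "real^'n^'n"
    and \<mu> lam \<rho> :: real
    and W :: "real^'z^'z" and Y Z :: "real^'n^'n"
    and Fh :: "real^'n^'n" and Gh :: "real^'y^'n" and Hh :: "real^'n^'z" and Kh :: "real^'y^'z"
  assumes "\<rho> > 0"
    and "schur_stable A" and "full_row_rank D" and "detectable A C" and "stabilizable A B"
    and "zero_one_diagonal T"
    and "symmetric W" and "symmetric Y" and "symmetric Z"
    and "trace W < \<mu>"
    and "positive_definite
      (sym_block W (L - Kh ** C - Hh ||| L - Kh ** C ||| - (Kh ** D))
      (sym_block Z (Z                ||| (0 :: real^'w^'n))
      (sym_block Y (0 :: real^'w^'n)
                 (mat 1 :: real^'w^'w))))"
    and "positive_definite
      (sym_block Z (Z ||| (0 :: real^'z^'n) ||| (0 :: real^'n^'n) ||| (0 :: real^'n^'n) ||| (0 :: real^'n^'n))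
      (sym_block Y (      (0 :: real^'z^'n) ||| Fh                ||| (0 :: real^'n^'n) ||| Gh ** C ** T)
      (sym_block (mat (lam / \<rho>\<^sup>2) :: real^'z^'z)
                   (                            Hh                ||| (0 :: real^'n^'z) ||| Kh ** C ** T)
      (sym_block Z (                                                  Z                 ||| (0 :: real^'n^'n))
      (sym_block Y (0 :: real^'n^'n)
                 (mat 1 :: real^'n^'n))))))"
    and "positive_definite
      (sym_block Z (Z ||| Z ** A                    ||| Z ** A               ||| Z ** B)
      (sym_block Y (      Y ** A + Gh ** C + Fh     ||| Y ** A + Gh ** C     ||| Y ** B + Gh ** D)
      (sym_block Z (                                    Z                    ||| (0 :: real^'w^'n))
      (sym_block Y (0 :: real^'w^'n)
                 (mat 1 :: real^'w^'w)))))"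
  shows "(\<exists>F G H K. admissible_filter A B C D L T \<mu> lam \<rho> F G H K) \<and>
    (\<exists>U V :: real^'n^'n. invertible U \<and> invertible V \<and>
       V ** transpose U = mat 1 - Y ** matrix_inv Z) \<and>
    (\<forall>U V :: real^'n^'n. invertible U \<and> invertible V \<and>
       V ** transpose U = mat 1 - Y ** matrix_inv Z \<longrightarrow>
       admissible_filter A B C D L T \<mu> lam \<rho>
         (matrix_inv V ** Fh ** matrix_inv Z ** transpose (matrix_inv U))
         (matrix_inv V ** Gh)
         (Hh ** matrix_inv Z ** transpose (matrix_inv U))
         Kh)"
proof -
  note pos = assms(1) and sym = assms(8,9) and tr = assms(10) and lmi = assms(11-13)
  have XZ: "0 < x \<bullet> ((Y - Z) *v x)" if "x \<noteq> 0" for x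
  proof -
    \<comment> \<open>Opposite entries reduce the block with entries \<open>Z\<close>,
      \<open>Z\<close>, \<open>Z\<close>, \<open>Y\<close> to \<open>Y - Z\<close>.\<close>
    have "vjoin 0 (vjoin x (vjoin (- x) 0)) \<noteq> 0" using that by simp
    from lmi(1)[unfolded positive_definite_def, THEN conjunct2, rule_format, OF this] show ?thesis
      by (simp add: sym_block_quadratic linear_neg matrix_vector_mult_diff_rdistrib inner_diff_right)
  qed
  have invZ: "invertible Z"
  proof -
    have "0 < x \<bullet> (Z *v x)" if "x \<noteq> 0" for x
    proof -
      have "vjoin 0 (vjoin x (vjoin 0 0)) \<noteq> 0" using that by simp
      from lmi(1)[unfolded positive_definite_def, THEN conjunct2, rule_format, OF this] show ?thesis
        by (simp add: sym_block_quadratic)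
    qed
    then show ?thesis
      unfolding invertible_iff_kernel by (metis inner_zero_right less_irrefl)
  qed
  let ?N = "mat 1 - Y ** matrix_inv Z"
  \<comment> \<open>This is \<open>?N = - (Y - Z) ** matrix_inv Z\<close> without the inverse;
    definiteness of \<open>Y - Z\<close> will make \<open>?N\<close> nonsingular.\<close>
  have N_mult: "?N *v (Z *v x) = - ((Y - Z) *v x)" for x
  proof -
    have "matrix_inv Z *v (Z *v x) = x"
      by (simp add: matrix_vector_mul_assoc matrix_inv_left[OF invZ])
    then show ?thesis
      by (simp add: matrix_vector_mult_diff_rdistrib flip: matrix_vector_mul_assoc)
  qed
  have "invertible ?N"
    unfolding invertible_iff_kernel
  proof (intro allI impI)
    fix x assume x: "?N *v x = 0"
    define y where "y = matrix_inv Z *v x"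
    have x_eq: "x = Z *v y"
      by (simp add: y_def matrix_vector_mul_assoc matrix_inv_right[OF invZ])
    have "(Y - Z) *v y = 0"
      using x N_mult[of y] by (simp add: x_eq)
    then have "y = 0" using XZ[of y] by force
    then show "x = 0" by (simp add: x_eq)
  qed
  then have ex: "\<exists>U V :: real^'n^'n. invertible U \<and> invertible V \<and> V ** transpose U = ?N"
    by (intro exI[of _ "mat 1"] exI[of _ ?N]) (simp add: invertible_def)
  have recovered: "admissible_filter A B C D L T \<mu> lam \<rho>
         (matrix_inv V ** Fh ** matrix_inv Z ** transpose (matrix_inv U))
         (matrix_inv V ** Gh)
         (Hh ** matrix_inv Z ** transpose (matrix_inv U))
         Kh"
    if UV: "invertible U" "invertible V" "V ** transpose U = ?N" for U V :: "real^'n^'n"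
  proof -
    define S where "S = matrix_inv Z ** transpose (matrix_inv U)"
    have UtUi: "transpose U ** transpose (matrix_inv U) = mat 1"
      by (metis UV(1) matrix_inv_left matrix_transpose_mul transpose_mat)
    \<comment> \<open>\<open>transpose U ** Z\<close> is the inverse coordinate change, so
      \<open>?N ** Z ** S = V\<close>, which gives the condition on \<open>J\<close> for
      \<open>J = matrix_inv V\<close>.\<close>
    have S_inverse: "transpose U ** Z ** S = mat 1"
      by (metis S_def UtUi invZ matrix_inv_right matrix_mul_assoc matrix_mul_rid)
    then have "invertible S"
      by (metis invertible_def matrix_left_right_inverse)
    moreover have "(Y - Z) *v (S *v (matrix_inv V *v y)) = - y" for y
    proof -
      let ?t = "S *v (matrix_inv V *v y)"
      have "?N *v (Z *v ?t) = V *v ((transpose U ** Z ** S) *v (matrix_inv V *v y))"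
        unfolding UV(3)[symmetric] by (simp only: matrix_vector_mul_assoc matrix_mul_assoc)
      also have "\<dots> = y"
        unfolding S_inverse by (simp add: matrix_vector_mul_assoc matrix_inv_right[OF UV(2)])
      finally show ?thesis unfolding N_mult by (metis minus_minus)
    qed
    ultimately show ?thesis
      using recovered_filter_admissible[OF pos sym tr lmi, of S "matrix_inv V"]
      by (simp add: S_def matrix_mul_assoc)
  qed
  from ex recovered show ?thesis by blast
qed

end
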